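(* Let $R$ be one of the chain rings $\mathbb{G}_4=\mathbb{Z}_4[X]/(X^2+X+1)$, $\mathbb{S}_4=\mathbb{F}_4[X]/(X^2)$, $\mathbb{T}_4=\mathbb{F}_4[X;a\mapsto a^2]/(X^2)$. Then $\mathrm{m}_5(R)\le 68$.
   Context: $\mathbb{F}_4[X;a\mapsto a^2]$ denotes the skew polynomial ring with commutation rule $Xa=a^2X$. For a finite chain ring $R$ of length $2$ with residue field $\mathbb{F}_q$, the projective Hjelmslev plane $\mathrm{PHG}(2,R)$ is the incidence structure whose points are the free rank-$1$ submodules of the right module $R_R^3$, whose lines are the free rank-$2$ submodules of $R_R^3$, with incidence given by inclusion. A projective $(k,n)$-arc is a set of $k$ points meeting every line in at most $n$ points. For $0\le n\le q^2+q$, $\mathrm{m}_n(R)$ denotes the largest $k$ such that a projective $(k,n)$-arc exists in $\mathrm{PHG}(2,R)$. *)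

theory Defs
  imports "HOL-Algebra.Ring" "HOL-Library.FuncSet"
begin

text \<open>F_4 = {0,1,w,w^2} encoded as 0,1,2,3 (2 = w, 3 = w^2 = w+1); addition is bitwise xor.\<close>

definition f4add :: "nat \<Rightarrow> nat \<Rightarrow> nat" where
  "f4add a b = xor a b"

definition f4log :: "nat \<Rightarrow> nat" where
  "f4log a = (if a = 1 then 0 else if a = 2 then 1 else 2)"

definition f4exp :: "nat \<Rightarrow> nat" where
  "f4exp k = (if k = 0 then 1 else if k = 1 then 2 else 3)"

definition f4mul :: "nat \<Rightarrow> nat \<Rightarrow> nat" where
  "f4mul a b = (if a = 0 \<or> b = 0 then 0 else f4exp ((f4log a + f4log b) mod 3))"

definition f4frob :: "nat \<Rightarrow> nat" where
  "f4frob a = f4mul a a"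

text \<open>G_4 = Z_4[X]/(X^2+X+1): pair (a,b) stands for a + b X with a,b in Z_4, X^2 = -X - 1.\<close>
definition G4 :: "(nat \<times> nat) ring" where
  "G4 = \<lparr> carrier = {0..<4} \<times> {0..<4},
          mult = (\<lambda>(a,b) (c,d). ((a*c + 3*(b*d)) mod 4, (a*d + b*c + 3*(b*d)) mod 4)),
          one = (1, 0),
          zero = (0, 0),
          add = (\<lambda>(a,b) (c,d). ((a + c) mod 4, (b + d) mod 4)) \<rparr>"

text \<open>S_4 = F_4[X]/(X^2): pair (a,b) stands for a + b X, X^2 = 0, X central.\<close>
definition S4 :: "(nat \<times> nat) ring" where
  "S4 = \<lparr> carrier = {0..<4} \<times> {0..<4},
          mult = (\<lambda>(a,b) (c,d). (f4mul a c, f4add (f4mul a d) (f4mul b c))),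
          one = (1, 0),
          zero = (0, 0),
          add = (\<lambda>(a,b) (c,d). (f4add a c, f4add b d)) \<rparr>"

text \<open>T_4 = F_4[X; a \<mapsto> a^2]/(X^2): pair (a,b) stands for a + b X, X^2 = 0, X c = c^2 X,
  hence (a + bX)(c + dX) = ac + (ad + b c^2) X.\<close>
definition T4 :: "(nat \<times> nat) ring" where
  "T4 = \<lparr> carrier = {0..<4} \<times> {0..<4},
          mult = (\<lambda>(a,b) (c,d). (f4mul a c, f4add (f4mul a d) (f4mul b (f4frob c)))),
          one = (1, 0),
          zero = (0, 0),
          add = (\<lambda>(a,b) (c,d). (f4add a c, f4add b d)) \<rparr>"

type_synonym 'a vec3 = "'a \<times> 'a \<times> 'a"

definition vcarrier :: "('a, 'b) ring_scheme \<Rightarrow> 'a vec3 set" where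
  "vcarrier R = carrier R \<times> carrier R \<times> carrier R"

definition vzero :: "('a, 'b) ring_scheme \<Rightarrow> 'a vec3" where
  "vzero R = (\<zero>\<^bsub>R\<^esub>, \<zero>\<^bsub>R\<^esub>, \<zero>\<^bsub>R\<^esub>)"

definition vadd :: "('a, 'b) ring_scheme \<Rightarrow> 'a vec3 \<Rightarrow> 'a vec3 \<Rightarrow> 'a vec3" where
  "vadd R u v = (case u of (x1, x2, x3) \<Rightarrow> case v of (y1, y2, y3) \<Rightarrow>
      (x1 \<oplus>\<^bsub>R\<^esub> y1, x2 \<oplus>\<^bsub>R\<^esub> y2, x3 \<oplus>\<^bsub>R\<^esub> y3))"

definition vsmul :: "('a, 'b) ring_scheme \<Rightarrow> 'a vec3 \<Rightarrow> 'a \<Rightarrow> 'a vec3" where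
  "vsmul R v r = (case v of (x1, x2, x3) \<Rightarrow> (x1 \<otimes>\<^bsub>R\<^esub> r, x2 \<otimes>\<^bsub>R\<^esub> r, x3 \<otimes>\<^bsub>R\<^esub> r))"

definition right_submodule :: "('a, 'b) ring_scheme \<Rightarrow> 'a vec3 set \<Rightarrow> bool" where
  "right_submodule R U \<longleftrightarrow> U \<subseteq> vcarrier R \<and> vzero R \<in> U \<and>
     (\<forall>u\<in>U. \<forall>v\<in>U. vadd R u v \<in> U) \<and>
     (\<forall>u\<in>U. \<forall>r\<in>carrier R. vsmul R u r \<in> U)"

fun lincomb :: "('a, 'b) ring_scheme \<Rightarrow> (nat \<Rightarrow> 'a vec3) \<Rightarrow> (nat \<Rightarrow> 'a) \<Rightarrow> nat \<Rightarrow> 'a vec3" where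
  "lincomb R v c 0 = vzero R"
| "lincomb R v c (Suc k) = vadd R (lincomb R v c k) (vsmul R (v k) (c k))"

definition free_rank :: "('a, 'b) ring_scheme \<Rightarrow> nat \<Rightarrow> 'a vec3 set \<Rightarrow> bool" where
  "free_rank R k U \<longleftrightarrow> (\<exists>v. (\<forall>i<k. v i \<in> vcarrier R) \<and>
      bij_betw (\<lambda>c. lincomb R v c k) ({0..<k} \<rightarrow>\<^sub>E carrier R) U)"

definition hpoints :: "('a, 'b) ring_scheme \<Rightarrow> 'a vec3 set set" where
  "hpoints R = {U. right_submodule R U \<and> free_rank R 1 U}"

definition hlines :: "('a, 'b) ring_scheme \<Rightarrow> 'a vec3 set set" where
  "hlines R = {U. right_submodule R U \<and> free_rank R 2 U}"

definition proj_arc :: "('a, 'b) ring_scheme \<Rightarrow> nat \<Rightarrow> nat \<Rightarrow> 'a vec3 set set \<Rightarrow> bool" where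
  "proj_arc R k n K \<longleftrightarrow> K \<subseteq> hpoints R \<and> card K = k \<and>
     (\<forall>L\<in>hlines R. card {P\<in>K. P \<subseteq> L} \<le> n)"

definition max_arc :: "('a, 'b) ring_scheme \<Rightarrow> nat \<Rightarrow> nat" where
  "max_arc R n = Max {k. \<exists>K. proj_arc R k n K}"

end

theory Submission
  imports Defs
begin

text \<open>
  Suppose an arc of size 69 exists. The points fall into 21 neighbour classes, the points of the
  residue plane PG(2,4), and a line class through a point class cuts it into four parallel segments.
  The four lines of a line class through a segment partition the other points of that line class;
  hence a segment with \<open>m\<close> points forces the other four classes on the line to
  contain at most \<open>4(5 - m)\<close> points. Summing over the five directions, every class has at most 4
  points, and a class with exactly 4 points is either a full segment, lying on a line class of weight
  at most 8, or a translate of a Baer subplane, which has three double directions with segments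
  \<open>2,2,0,0\<close>.

  Let \<open>d = 4 - weight\<close>, so that \<open>d\<close> sums to 15 over PG(2,4). A parity argument shows that a line class
  is a double direction for at most three classes; it has total \<open>d\<close> at least 4 if it is one for some
  class, and at least 6 if it is one for two classes and contains no empty class. Counting
  incidences between the classes with \<open>d = 0\<close> and their double directions, separately for each number
  of empty classes, is then contradictory.

  The rings enter only through their residue map to \<open>F\<^sub>4\<close> and their radical.
\<close>

section \<open>Deficiency functions on a plane of order four\<close>

text \<open>The value 69 is where the estimates become tight. For a class of four points, summing
  the segment bound over its five directions leaves total maximal multiplicity at most 8, an excess
  of 3 over the value 1 that each direction has anyway. The 12 ordered pairs of points in the class
  need at least that excess, so equality holds everywhere; this yields the dichotomy between full
  segment and Baer subplane. On the side of \<open>d\<close> the budget is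
  \<open>5 * 15 = 75\<close> over all lines, and each full class demands three double directions of
  cost at least 4. The danger is that one cheap line serves several classes; the bound 6 makes such
  sharing expensive. An empty class destroys that bound: the inequalities on a line class allow
  weights 4, 4, 4, 4, 0 with three double classes at cost 4. Hence the separation by the number of
  empty classes. Each of them can spoil one double direction per full class, but it also absorbs 4
  of the 15, so that more full classes have to be served from a smaller budget.\<close>

text \<open>A projective plane of order 4 with a polarity: \<open>perp x\<close> is both the set of points on the line
  \<open>x\<close> and the set of lines through the point \<open>x\<close>.\<close>

locale polar_plane =
  fixes pg :: "'a set" and perp :: "'a \<Rightarrow> 'a set"
  assumes finite_pg [simp]: "finite pg" and card_pg: "card pg = 21"
    and perp_subset: "perp h \<subseteq> pg"
    and perp_sym: "\<lbrakk>x \<in> pg; h \<in> perp x\<rbrakk> \<Longrightarrow> x \<in> perp h"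
    and card_perp: "h \<in> pg \<Longrightarrow> card (perp h) = 5"
    and join_unique: "\<lbrakk>x \<in> pg; y \<in> pg; x \<noteq> y\<rbrakk> \<Longrightarrow> \<exists>h. perp x \<inter> perp y = {h}"
begin

lemma finite_perp [simp]: "finite (perp h)"
  by (rule finite_subset[OF perp_subset finite_pg])

lemma perp_in_pg: "x \<in> perp h \<Longrightarrow> x \<in> pg"
  using perp_subset by blast

lemma join_eq:
  "\<lbrakk>x \<in> pg; y \<in> pg; x \<noteq> y; h \<in> perp x; h \<in> perp y; k \<in> perp x; k \<in> perp y\<rbrakk> \<Longrightarrow> h = k"
  by (metis IntI join_unique singletonD)

lemma pencil_sum:
  fixes f :: "'a \<Rightarrow> nat"
  assumes "x \<in> pg"
  shows "(\<Sum>h\<in>perp x. \<Sum>y\<in>perp h - {x}. f y) = (\<Sum>y\<in>pg - {x}. f y)"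
proof -
  have "(\<Sum>h\<in>perp x. \<Sum>y\<in>perp h - {x}. f y) = (\<Sum>y\<in>(\<Union>h\<in>perp x. perp h - {x}). f y)"
  proof (rule sum.UNION_disjoint[symmetric])
    show "\<forall>h\<in>perp x. \<forall>k\<in>perp x. h \<noteq> k \<longrightarrow> (perp h - {x}) \<inter> (perp k - {x}) = {}"
    proof (intro ballI impI, rule ccontr)
      fix h k assume hk: "h \<in> perp x" "k \<in> perp x" "h \<noteq> k" "(perp h - {x}) \<inter> (perp k - {x}) \<noteq> {}"
      then obtain y where "y \<in> perp h" "y \<in> perp k" "y \<noteq> x" by blast
      then show False using join_eq[OF assms, of y h k] hk by (metis perp_in_pg perp_sym)
    qed
  qed auto
  also have "(\<Union>h\<in>perp x. perp h - {x}) = pg - {x}"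
  proof (intro equalityI subsetI)
    fix y assume y: "y \<in> pg - {x}"
    then obtain h where "perp x \<inter> perp y = {h}" using join_unique[OF assms, of y] by blast
    then have "h \<in> perp x" "h \<in> perp y" by auto
    moreover have "y \<in> perp h" using \<open>h \<in> perp y\<close> y by (simp add: perp_sym)
    ultimately show "y \<in> (\<Union>h\<in>perp x. perp h - {x})" using y by blast
  qed (auto dest: perp_in_pg)
  finally show ?thesis .
qed

lemma lines_sum:
  fixes f :: "'a \<Rightarrow> nat"
  assumes "H \<subseteq> pg"
  shows "(\<Sum>h\<in>H. \<Sum>x\<in>perp h. f x) = (\<Sum>x\<in>pg. f x * card (perp x \<inter> H))"
proof -
  have fH: "finite H" by (rule finite_subset[OF assms finite_pg])
  have "(\<Sum>h\<in>H. \<Sum>x\<in>perp h. f x) = (\<Sum>h\<in>H. \<Sum>x\<in>{x \<in> pg. x \<in> perp h}. f x)"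
    by (intro sum.cong refl) (auto dest: perp_in_pg)
  also have "\<dots> = (\<Sum>x\<in>pg. \<Sum>h\<in>{h \<in> H. x \<in> perp h}. f x)"
    by (rule sum.swap_restrict[OF fH finite_pg])
  also have "\<dots> = (\<Sum>x\<in>pg. f x * card (perp x \<inter> H))"
  proof (rule sum.cong[OF refl])
    fix x assume "x \<in> pg"
    then have "{h \<in> H. x \<in> perp h} = perp x \<inter> H" using assms perp_sym by blast
    then show "(\<Sum>h\<in>{h \<in> H. x \<in> perp h}. f x) = f x * card (perp x \<inter> H)" by simp
  qed
  finally show ?thesis .
qed

end

lemma double_count:
  assumes "finite A" "finite B"
  shows "(\<Sum>x\<in>A. card {h \<in> B. R h x}) = (\<Sum>h\<in>B. card {x \<in> A. R h x})"
  using sum.swap_restrict[OF assms, of "\<lambda>_ _. 1::nat" "\<lambda>x h. R h x"] by simp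

text \<open>\<open>d x\<close> is four minus the number of arc points in the class \<open>x\<close>, and \<open>D h x\<close> says that \<open>h\<close> cuts
  the four points of the class \<open>x\<close> into two segments of two points.\<close>

locale deficiency = polar_plane +
  fixes d :: "'a \<Rightarrow> nat" and D :: "'a \<Rightarrow> 'a \<Rightarrow> bool" and dl :: "'a \<Rightarrow> nat"
  defines "dl h \<equiv> (\<Sum>x\<in>perp h. d x)"
  assumes d_le_4: "x \<in> pg \<Longrightarrow> d x \<le> 4" and sum_d: "(\<Sum>x\<in>pg. d x) = 15"
    and D_imp: "D h x \<Longrightarrow> h \<in> pg \<and> x \<in> perp h \<and> d x = 0"
    and card_D_line: "h \<in> pg \<Longrightarrow> card {x \<in> pg. D h x} \<le> 3"
    and D_dl: "D h x \<Longrightarrow> 4 \<le> dl h"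
    and two_D_dl: "\<lbrakk>D h x; D h y; x \<noteq> y; \<forall>z\<in>perp h. d z \<noteq> 4\<rbrakk> \<Longrightarrow> 6 \<le> dl h"
    and zero_cases: "\<lbrakk>x \<in> pg; d x = 0\<rbrakk> \<Longrightarrow> (\<exists>h\<in>perp x. 12 \<le> dl h) \<or> 3 \<le> card {h \<in> pg. D h x}"
    and one_dl: "\<lbrakk>x \<in> pg; d x = 1\<rbrakk> \<Longrightarrow> \<exists>h\<in>perp x. 5 \<le> dl h"
begin

section \<open>Deficiency of single lines and of pairs of lines\<close>

lemma sum_d_subset: "A \<subseteq> pg \<Longrightarrow> (\<Sum>x\<in>A. d x) \<le> 15"
  using sum_mono2[OF finite_pg, of A d] sum_d by simp

lemma card_nonzero_le:
  assumes "finite A" shows "card {x \<in> A. d x \<noteq> 0} \<le> (\<Sum>x\<in>A. d x)"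
proof -
  have "card {x \<in> A. d x \<noteq> 0} = (\<Sum>x\<in>A. if d x \<noteq> 0 then 1 else 0)"
    using assms by (simp add: sum.If_cases Int_def)
  also have "\<dots> \<le> (\<Sum>x\<in>A. d x)" by (intro sum_mono) simp
  finally show ?thesis .
qed

lemma pencil_d:
  assumes x: "x \<in> pg" shows "(\<Sum>h\<in>perp x. \<Sum>y\<in>perp h - {x}. d y) + d x = 15"
  using pencil_sum[OF x, of d] sum.remove[OF finite_pg x, of d] sum_d by simp

lemma dl_remove: "x \<in> perp h \<Longrightarrow> dl h = d x + (\<Sum>y\<in>perp h - {x}. d y)"
  unfolding dl_def by (rule sum.remove[OF finite_perp])

lemma pencil_dl:
  assumes x: "x \<in> pg" "d x = 0" shows "(\<Sum>h\<in>perp x. dl h) = 15"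
proof -
  have "(\<Sum>h\<in>perp x. dl h) = (\<Sum>h\<in>perp x. \<Sum>y\<in>perp h - {x}. d y)"
    using x by (intro sum.cong refl) (simp add: dl_remove[OF perp_sym[OF x(1)]])
  then show ?thesis using pencil_d[OF x(1)] x(2) by simp
qed

lemma two_lines:
  assumes "h \<in> pg" "k \<in> pg" "h \<noteq> k"
  obtains p where "p \<in> perp h" "p \<in> perp k" "dl h + dl k = d p + (\<Sum>x\<in>perp h \<union> perp k. d x)"
proof -
  obtain p where p: "perp h \<inter> perp k = {p}" using join_unique[OF assms] by blast
  then have "dl h + dl k = d p + (\<Sum>x\<in>perp h \<union> perp k. d x)"
    unfolding dl_def using sum.union_inter[of "perp h" "perp k" d] by simp
  then show thesis using that p by blast
qed

text \<open>Only the common point is counted twice, and it contributes at most 4 beyond the total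
  15.\<close>

lemma two_lines_le:
  assumes "h \<in> pg" "k \<in> pg" "h \<noteq> k" shows "dl h + dl k \<le> 19"
proof -
  obtain p where "p \<in> perp h" "dl h + dl k = d p + (\<Sum>x\<in>perp h \<union> perp k. d x)"
    using two_lines[OF assms] by metis
  moreover have "d p \<le> 4" using d_le_4 \<open>p \<in> perp h\<close> perp_subset by blast
  moreover have "(\<Sum>x\<in>perp h \<union> perp k. d x) \<le> 15"
    by (rule sum_d_subset) (simp add: perp_subset)
  ultimately show ?thesis by linarith
qed

text \<open>This removes the full-segment alternative of \<open>zero_cases\<close>. Off a line
  \<open>l\<close> with \<open>dl l >= 12\<close> the total of \<open>d\<close> is at most 3, so
  most of the 16 affine classes are full. Each of these has three double lines, and a line serves at
  most three classes, so there are at least \<open>card Z\<close> lines other than \<open>l\<close>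
  with \<open>dl >= 4\<close>. But such lines need weight on \<open>l\<close>: counted by their
  intersection with \<open>l\<close> there are at most \<open>dl l\<close>, which is less than
  \<open>card Z\<close>.\<close>

lemma dl_le_11:
  assumes l: "l \<in> pg" shows "dl l \<le> 11"
proof (rule ccontr)
  assume heavy: "\<not> ?thesis"
  define Aff where "Aff = pg - perp l"
  have sumAff: "(\<Sum>x\<in>Aff. d x) + dl l = 15"
    unfolding Aff_def dl_def using sum.subset_diff[OF perp_subset finite_pg, of d] sum_d by simp
  have cardAff: "card Aff = 16"
    unfolding Aff_def using card_Diff_subset[OF finite_perp perp_subset] card_pg card_perp[OF l] by simp
  define Z where "Z = {x \<in> Aff. d x = 0}"
  define H where "H = {h \<in> pg - {l}. 4 \<le> dl h}"
  have fin: "finite Aff" "finite Z" "finite H" by (simp_all add: Aff_def Z_def H_def)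
  have "card Aff = card Z + card {x \<in> Aff. d x \<noteq> 0}"
    unfolding Z_def using fin(1) by (subst card_Un_disjoint[symmetric]) (auto intro: arg_cong[where f=card])
  \<comment> \<open>At most \<open>15 - dl l\<close> of the 16 affine classes have nonzero
    \<open>d\<close>.\<close>
  then have cardZ: "1 + dl l \<le> card Z"
    using cardAff card_nonzero_le[OF fin(1)] sumAff by linarith
  have three: "3 \<le> card {h \<in> H. D h x}" if "x \<in> Z" for x
  proof -
    have x: "x \<in> pg" "x \<notin> perp l" "d x = 0" using that by (auto simp: Z_def Aff_def)
    have "\<not> (\<exists>h\<in>perp x. 12 \<le> dl h)"
    proof
      assume "\<exists>h\<in>perp x. 12 \<le> dl h"
      then obtain h where h: "h \<in> perp x" "12 \<le> dl h" by blast
      then have "h \<in> pg" "h \<noteq> l" using x perp_in_pg perp_sym by blast+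
      then show False using two_lines_le[OF _ l] h(2) heavy by fastforce
    qed
    then have "3 \<le> card {h \<in> pg. D h x}" using zero_cases[OF x(1,3)] by blast
    also have "{h \<in> pg. D h x} = {h \<in> H. D h x}"
      unfolding H_def using x(2) D_imp D_dl by blast
    finally show ?thesis .
  qed
  have "3 * card Z \<le> (\<Sum>x\<in>Z. card {h \<in> H. D h x})"
    using sum_mono[OF three, of Z "\<lambda>x. x"] by simp
  also have "\<dots> = (\<Sum>h\<in>H. card {x \<in> Z. D h x})" by (rule double_count[OF fin(2,3)])
  also have "\<dots> \<le> (\<Sum>h\<in>H. 3)"
  proof (rule sum_mono)
    fix h assume "h \<in> H"
    then have "card {x \<in> pg. D h x} \<le> 3" using card_D_line by (simp add: H_def)
    moreover have "card {x \<in> Z. D h x} \<le> card {x \<in> pg. D h x}"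
      by (intro card_mono) (auto simp: Z_def Aff_def)
    ultimately show "card {x \<in> Z. D h x} \<le> 3" by simp
  qed
  finally have ZH: "card Z \<le> card H" by simp
  have "H \<subseteq> (\<Union>r\<in>perp l. {h \<in> H. h \<in> perp r})"
  proof
    fix h assume h: "h \<in> H"
    then have "h \<in> pg" "h \<noteq> l" by (auto simp: H_def)
    then obtain r where r: "r \<in> perp h" "r \<in> perp l" using two_lines[OF _ l] by metis
    then have "h \<in> perp r" using \<open>h \<in> pg\<close> perp_sym by blast
    then show "h \<in> (\<Union>r\<in>perp l. {h \<in> H. h \<in> perp r})" using r h by blast
  qed
  then have "card H \<le> card (\<Union>r\<in>perp l. {h \<in> H. h \<in> perp r})"
    using fin by (intro card_mono) auto
  also have "\<dots> \<le> (\<Sum>r\<in>perp l. card {h \<in> H. h \<in> perp r})" by (rule card_UN_le) simp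
  \<comment> \<open>A line of \<open>H\<close> through \<open>r\<close> needs \<open>4 - d r\<close>
    from the affine classes, whose total is at most 3. So \<open>n\<close> such lines satisfy
    \<open>n * (4 - d r) \<le> 3\<close>, and with \<open>n \<le> 4\<close> this gives
    \<open>n \<le> d r\<close>.\<close>
  also have "\<dots> \<le> (\<Sum>r\<in>perp l. d r)"
  proof (rule sum_mono)
    fix r assume r: "r \<in> perp l"
    then have rp: "r \<in> pg" using perp_subset by blast
    have lr: "l \<in> perp r" using r l perp_sym by blast
    let ?N = "{h \<in> H. h \<in> perp r}"
    have sub: "?N \<subseteq> perp r - {l}" by (auto simp: H_def)
    have "card ?N \<le> 4"
      using card_mono[OF _ sub] card_perp[OF rp] lr by simp
    have "(\<Sum>h\<in>perp r - {l}. \<Sum>y\<in>perp h - {r}. d y) + dl l = 15"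
      using pencil_d[OF rp] dl_remove[OF r] sum.remove[OF finite_perp lr, of "\<lambda>h. \<Sum>y\<in>perp h - {r}. d y"] by simp
    moreover have "(\<Sum>h\<in>?N. 4 - d r) \<le> (\<Sum>h\<in>?N. \<Sum>y\<in>perp h - {r}. d y)"
    proof (rule sum_mono)
      fix h assume h: "h \<in> ?N"
      then have "r \<in> perp h" using rp perp_sym by blast
      moreover have "4 \<le> dl h" using h by (simp add: H_def)
      ultimately show "4 - d r \<le> (\<Sum>y\<in>perp h - {r}. d y)" using dl_remove[of r h] by linarith
    qed
    moreover have "(\<Sum>h\<in>?N. \<Sum>y\<in>perp h - {r}. d y) \<le> (\<Sum>h\<in>perp r - {l}. \<Sum>y\<in>perp h - {r}. d y)"
      using sub by (intro sum_mono2) auto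
    ultimately have "card ?N * (4 - d r) \<le> 3" using heavy by simp
    moreover have "n \<le> e" if "n * (4 - e) \<le> 3" "n \<le> 4" "e \<le> 4" for n e :: nat
    proof -
      have "e = 0 \<or> e = 1 \<or> e = 2 \<or> e = 3 \<or> e = 4" using that(3) by linarith
      then show ?thesis using that(1,2) by (elim disjE) simp_all
    qed
    ultimately show "card ?N \<le> d r" using \<open>card ?N \<le> 4\<close> d_le_4[OF rp] by blast
  qed
  finally have "card H \<le> dl l" by (simp add: dl_def)
  then show False using ZH cardZ by simp
qed

lemma three_D: "\<lbrakk>x \<in> pg; d x = 0\<rbrakk> \<Longrightarrow> 3 \<le> card {h \<in> pg. D h x}"
proof -
  assume x: "x \<in> pg" "d x = 0"
  have "\<not> 12 \<le> dl h" if "h \<in> perp x" for h using dl_le_11[OF perp_in_pg[OF that]] by simp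
  then show ?thesis using zero_cases[OF x] by blast
qed

text \<open>Two such lines and a third double line through \<open>x\<close> would cost
  \<open>6 + 6 + 4\<close>, but the pencil of a full class has total 15.\<close>

lemma card_big_le_1:
  assumes x: "x \<in> pg" "d x = 0" shows "card {h \<in> pg. D h x \<and> 6 \<le> dl h} \<le> 1"
proof (rule ccontr)
  assume "\<not> ?thesis"
  then obtain h k where hk: "h \<in> {h \<in> pg. D h x \<and> 6 \<le> dl h}" "k \<in> {h \<in> pg. D h x \<and> 6 \<le> dl h}" "h \<noteq> k"
    using card_le_Suc0_iff_eq[of "{h \<in> pg. D h x \<and> 6 \<le> dl h}"] by auto
  have "\<not> {h \<in> pg. D h x} \<subseteq> {h, k}"
    using three_D[OF x] hk(3) card_mono[of "{h, k}" "{h \<in> pg. D h x}"] by auto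
  then obtain m where m: "D m x" "m \<noteq> h" "m \<noteq> k" by blast
  have mem: "j \<in> perp x" if "D j x" for j using D_imp[OF that] perp_sym by blast
  have "(\<Sum>j\<in>{h, k, m}. dl j) \<le> (\<Sum>j\<in>perp x. dl j)"
    using mem hk m by (intro sum_mono2) auto
  then show False using hk m D_dl[OF m(1)] pencil_dl[OF x] by simp
qed

text \<open>\<open>Zs\<close> and \<open>Os\<close> are the full and the empty classes, \<open>Ms\<close> the lines missing all empty
  classes, and \<open>As\<close>, \<open>Bs\<close> the light and the heavy lines of \<open>Ms\<close> in a double direction of some class.\<close>

definition "Zs = {x \<in> pg. d x = 0}"
definition "Os = {x \<in> pg. d x = 4}"
definition "Ms = {h \<in> pg. perp h \<inter> Os = {}}"
definition "As = {h \<in> Ms. dl h < 6 \<and> (\<exists>x. D h x)}"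
definition "Bs = {h \<in> Ms. 6 \<le> dl h \<and> (\<exists>x. D h x)}"

lemma finite_sets [simp]: "finite Zs" "finite Os" "finite Ms" "finite As" "finite Bs"
  by (simp_all add: Zs_def Os_def Ms_def As_def Bs_def)

lemma AB: "As \<inter> Bs = {}" "As \<union> Bs \<subseteq> Ms" by (auto simp: As_def Bs_def)

lemma card_D_As: "h \<in> As \<Longrightarrow> card {x \<in> Zs. D h x} \<le> 1"
proof -
  assume h: "h \<in> As"
  have "x = y" if "D h x" "D h y" for x y
  proof (rule ccontr)
    assume "x \<noteq> y"
    moreover have "\<forall>z\<in>perp h. d z \<noteq> 4" using h perp_subset[of h] by (auto simp: As_def Ms_def Os_def)
    ultimately show False using two_D_dl[OF that] h by (simp add: As_def)
  qed
  then show ?thesis using card_le_Suc0_iff_eq[of "{x \<in> Zs. D h x}"] by auto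
qed

text \<open>An empty class lies on exactly one line through \<open>x\<close>, so it spoils at most
  one of the three double lines.\<close>

lemma three_D_Ms: "x \<in> Zs \<Longrightarrow> 3 \<le> card {h \<in> Ms. D h x} + card Os"
proof -
  assume "x \<in> Zs"
  then have x: "x \<in> pg" "d x = 0" by (auto simp: Zs_def)
  have sub: "{h \<in> pg. D h x} \<subseteq> {h \<in> Ms. D h x} \<union> (\<Union>P\<in>Os. perp x \<inter> perp P)"
  proof
    fix h assume h: "h \<in> {h \<in> pg. D h x}"
    show "h \<in> {h \<in> Ms. D h x} \<union> (\<Union>P\<in>Os. perp x \<inter> perp P)"
    proof (cases "h \<in> Ms")
      case False
      then obtain P where P: "P \<in> perp h" "P \<in> Os" using h by (auto simp: Ms_def)
      then have "h \<in> perp P" "h \<in> perp x"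
        using h D_imp[of h x] perp_sym by blast+
      then show ?thesis using P by blast
    qed (use h in simp)
  qed
  have "card (perp x \<inter> perp P) = 1" if "P \<in> Os" for P
  proof -
    have "P \<in> pg" "P \<noteq> x" using that x by (auto simp: Os_def)
    then obtain h where "perp x \<inter> perp P = {h}" using join_unique[OF x(1), of P] by blast
    then show ?thesis by simp
  qed
  then have "card (\<Union>P\<in>Os. perp x \<inter> perp P) \<le> card Os"
    using card_UN_le[of Os "\<lambda>P. perp x \<inter> perp P"] by simp
  moreover have "card {h \<in> pg. D h x} \<le> card ({h \<in> Ms. D h x} \<union> (\<Union>P\<in>Os. perp x \<inter> perp P))"
    by (intro card_mono sub) auto
  moreover have "\<dots> \<le> card {h \<in> Ms. D h x} + card (\<Union>P\<in>Os. perp x \<inter> perp P)" by (rule card_Un_le)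
  ultimately show ?thesis using three_D[OF x] by linarith
qed

text \<open>Incidences between full classes and their double lines in \<open>Ms\<close>: a light
  line serves at most one class by \<open>two_D_dl\<close>, a heavy line at most three.\<close>

lemma count_Ms: "(3 - card Os) * card Zs \<le> card As + 3 * card Bs"
proof -
  have "(3 - card Os) * card Zs \<le> (\<Sum>x\<in>Zs. card {h \<in> Ms. D h x})"
    using sum_mono[of Zs "\<lambda>_. 3 - card Os" "\<lambda>x. card {h \<in> Ms. D h x}"] three_D_Ms
    by (simp add: mult.commute le_diff_conv)
  also have "\<dots> = (\<Sum>x\<in>Zs. card {h \<in> As \<union> Bs. D h x})"
    by (intro sum.cong refl arg_cong[where f=card]) (auto simp: As_def Bs_def)
  also have "\<dots> = (\<Sum>h\<in>As \<union> Bs. card {x \<in> Zs. D h x})" by (rule double_count) simp_all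
  also have "\<dots> = (\<Sum>h\<in>As. card {x \<in> Zs. D h x}) + (\<Sum>h\<in>Bs. card {x \<in> Zs. D h x})"
    by (rule sum.union_disjoint) (simp_all add: AB)
  also have "\<dots> \<le> (\<Sum>h\<in>As. 1) + (\<Sum>h\<in>Bs. 3)"
  proof (intro add_mono sum_mono card_D_As)
    fix h assume "h \<in> Bs"
    then have "card {x \<in> pg. D h x} \<le> 3" using card_D_line by (simp add: Bs_def Ms_def)
    moreover have "card {x \<in> Zs. D h x} \<le> card {x \<in> pg. D h x}" by (intro card_mono) (auto simp: Zs_def)
    ultimately show "card {x \<in> Zs. D h x} \<le> 3" by simp
  qed
  finally show ?thesis by simp
qed

text \<open>At most one double line of a full class is heavy, so \<open>2 - card Os\<close> light
  ones remain, and no two full classes share a light one.\<close>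

lemma count_As: "(2 - card Os) * card Zs \<le> card As"
proof -
  have two: "2 - card Os \<le> card {h \<in> As. D h x}" if "x \<in> Zs" for x
  proof -
    have "card {h \<in> Ms. D h x} \<le> card ({h \<in> As. D h x} \<union> {h \<in> pg. D h x \<and> 6 \<le> dl h})"
      by (intro card_mono) (auto simp: As_def Ms_def)
    also have "\<dots> \<le> card {h \<in> As. D h x} + card {h \<in> pg. D h x \<and> 6 \<le> dl h}" by (rule card_Un_le)
    finally show ?thesis using three_D_Ms[OF that] card_big_le_1[of x] that by (simp add: Zs_def)
  qed
  have "(2 - card Os) * card Zs \<le> (\<Sum>x\<in>Zs. card {h \<in> As. D h x})"
    using sum_mono[OF two, of Zs "\<lambda>x. x"] by (simp add: mult.commute)
  also have "\<dots> = (\<Sum>h\<in>As. card {x \<in> Zs. D h x})" by (rule double_count) simp_all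
  also have "\<dots> \<le> (\<Sum>h\<in>As. 1)" by (intro sum_mono card_D_As)
  finally show ?thesis by simp
qed

lemma count_dl: "4 * card As + 6 * card Bs \<le> (\<Sum>h\<in>Ms. dl h)"
proof -
  have "4 * card As + 6 * card Bs = (\<Sum>h\<in>As. 4) + (\<Sum>h\<in>Bs. 6)" by simp
  also have "\<dots> \<le> (\<Sum>h\<in>As. dl h) + (\<Sum>h\<in>Bs. dl h)"
    by (intro add_mono sum_mono) (auto simp: As_def Bs_def intro: D_dl)
  also have "\<dots> = (\<Sum>h\<in>As \<union> Bs. dl h)" by (rule sum.union_disjoint[symmetric]) (simp_all add: AB)
  also have "\<dots> \<le> (\<Sum>h\<in>Ms. dl h)" using AB by (intro sum_mono2) auto
  finally show ?thesis .
qed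

section \<open>Elimination of each possible number of empty classes\<close>

lemma sum_d_not_Os: "(\<Sum>x\<in>pg - Os. d x) + 4 * card Os = 15"
proof -
  have "(\<Sum>x\<in>Os. d x) = (\<Sum>x\<in>Os. 4)" by (intro sum.cong) (auto simp: Os_def)
  moreover have "Os \<subseteq> pg" by (auto simp: Os_def)
  ultimately show ?thesis using sum.subset_diff[of Os pg d] sum_d by simp
qed

text \<open>Outside \<open>Os\<close> the total is \<open>15 - 4 * card Os\<close>, which bounds the
  number of classes there with nonzero \<open>d\<close>; the rest of the 21 classes is full.\<close>

lemma card_Zs: "6 + 3 * card Os \<le> card Zs"
proof -
  have "pg = Zs \<union> (Os \<union> {x \<in> pg - Os. d x \<noteq> 0})" by (auto simp: Zs_def Os_def)
  then have "card pg \<le> card Zs + card (Os \<union> {x \<in> pg - Os. d x \<noteq> 0})" by (metis card_Un_le)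
  also have "\<dots> \<le> card Zs + (card Os + card {x \<in> pg - Os. d x \<noteq> 0})" by (simp add: card_Un_le)
  finally show ?thesis using card_pg card_nonzero_le[of "pg - Os"] sum_d_not_Os by simp
qed

text \<open>Empty classes lie on no line of \<open>Ms\<close>. Any other class loses the line
  joining it to a fixed empty class, so its \<open>d\<close> is counted at most four times:
  \<open>4 * (15 - 4 * card Os)\<close>.\<close>

lemma sum_dl_Ms:
  assumes "Os \<noteq> {}" shows "(\<Sum>h\<in>Ms. dl h) + 16 * card Os \<le> 60"
proof -
  obtain P where P: "P \<in> Os" using assms by blast
  have "Ms \<subseteq> pg" by (auto simp: Ms_def)
  then have "(\<Sum>h\<in>Ms. dl h) = (\<Sum>x\<in>pg. d x * card (perp x \<inter> Ms))"
    unfolding dl_def by (rule lines_sum)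
  also have "\<dots> \<le> (\<Sum>x\<in>pg. if x \<in> Os then 0 else 4 * d x)"
  proof (rule sum_mono)
    fix x assume x: "x \<in> pg"
    show "d x * card (perp x \<inter> Ms) \<le> (if x \<in> Os then 0 else 4 * d x)"
    proof (cases "x \<in> Os")
      case True
      then have "perp x \<inter> Ms = {}" using x perp_sym by (auto simp: Ms_def)
      then show ?thesis by simp
    next
      case False
      then obtain h where h: "perp x \<inter> perp P = {h}" using join_unique[OF x, of P] P by (auto simp: Os_def)
      then have "h \<in> perp x" "h \<in> perp P" by auto
      then have "h \<notin> Ms" using P perp_sym[of P h] by (auto simp: Ms_def Os_def)
      then have "card (perp x \<inter> Ms) \<le> card (perp x - {h})" by (intro card_mono) auto
      also have "\<dots> = 4" using card_perp[OF x] \<open>h \<in> perp x\<close> by simp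
      finally show ?thesis using False by simp
    qed
  qed
  also have "\<dots> = (\<Sum>x\<in>pg - Os. 4 * d x)"
    by (simp add: sum.If_cases Diff_eq)
  finally show ?thesis using sum_d_not_Os by (simp add: sum_distrib_left[symmetric])
qed

text \<open>Only 3 of the total is left outside the empty classes, so every double line passes
  through an empty class. This makes the lines joining empty classes so heavy that two of them
  exceed the bound 19.\<close>

lemma card_Os_neq_3: "card Os \<noteq> 3"
proof
  assume c3: "card Os = 3"
  then obtain P Q R where PQR: "Os = {P, Q, R}" "P \<noteq> Q" "Q \<noteq> R" "P \<noteq> R"
    by (auto simp: card_3_iff)
  have rest: "(\<Sum>x\<in>pg - Os. d x) = 3" using sum_d_not_Os c3 by simp
  have miss: "h \<notin> Ms" if "D h x" for h x
  proof
    assume "h \<in> Ms"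
    then have "perp h \<subseteq> pg - Os" using perp_subset by (auto simp: Ms_def)
    then have "dl h \<le> 3" unfolding dl_def rest[symmetric] by (intro sum_mono2) auto
    then show False using D_dl[OF that] by simp
  qed
  \<comment> \<open>A full class on the join of \<open>A\<close> and \<open>B\<close> would have at
    most two candidates for double lines, this join and its line to \<open>C\<close>. So the other
    three classes on the join all have \<open>d >= 1\<close>, giving
    \<open>4 + 4 + 3\<close>.\<close>
  have heavy: "11 \<le> dl l" if l: "l \<in> pg" "A \<in> perp l" "B \<in> perp l" and AB: "Os = {A, B, C}" "A \<noteq> B" for l A B C
  proof -
    have AB': "A \<in> pg" "B \<in> pg" "C \<in> pg" "d A = 4" "d B = 4" "d C = 4" using AB by (auto simp: Os_def)
    have lA: "l \<in> perp A" "l \<in> perp B" using l AB' perp_sym by blast+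
    have nz: "d r \<noteq> 0" if r: "r \<in> perp l" for r
    proof
      assume z: "d r = 0"
      then have rp: "r \<in> pg" "r \<noteq> A" "r \<noteq> B" "r \<noteq> C" using r AB' perp_in_pg by auto
      obtain m where m: "perp r \<inter> perp C = {m}" using join_unique[OF rp(1) AB'(3) rp(4)] by blast
      have lr: "l \<in> perp r" using r l(1) perp_sym by blast
      have "{h \<in> pg. D h r} \<subseteq> {l, m}"
      proof
        fix h assume h: "h \<in> {h \<in> pg. D h r}"
        then obtain T where T: "T \<in> Os" "T \<in> perp h" using miss[of h r] by (auto simp: Ms_def)
        have "h \<in> perp r" using h D_imp[of h r] perp_sym by blast
        moreover have "h \<in> perp T" using T h perp_sym by blast
        moreover consider "T = A" | "T = B" | "T = C" using T(1) AB(1) by blast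
        ultimately have "h = l \<or> h \<in> perp r \<inter> perp C"
          using join_eq[OF rp(1) AB'(1) rp(2) _ _ lr lA(1)] join_eq[OF rp(1) AB'(2) rp(3) _ _ lr lA(2)]
          by (metis IntI)
        then show "h \<in> {l, m}" using m by simp
      qed
      then have "card {h \<in> pg. D h r} \<le> card {l, m}" by (intro card_mono) auto
      also have "\<dots> \<le> 2" by (simp add: card_insert_if)
      finally show False using three_D[OF rp(1) z] by simp
    qed
    have "card (perp l - {A} - {B}) = 3" using card_perp[OF l(1)] l AB by simp
    moreover have "{x \<in> perp l - {A} - {B}. d x \<noteq> 0} = perp l - {A} - {B}" using nz by blast
    ultimately have "3 \<le> (\<Sum>x\<in>perp l - {A} - {B}. d x)"
      using card_nonzero_le[of "perp l - {A} - {B}"] by simp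
    moreover have "dl l = d A + (d B + (\<Sum>x\<in>perp l - {A} - {B}. d x))"
      using dl_remove[OF l(2)] sum.remove[of "perp l - {A}" B d] l AB by simp
    ultimately show ?thesis using AB' by simp
  qed
  have pg3: "P \<in> pg" "Q \<in> pg" "R \<in> pg" "d P = 4" "d Q = 4" "d R = 4" using PQR by (auto simp: Os_def)
  obtain l where "perp P \<inter> perp Q = {l}" using join_unique[OF pg3(1,2) PQR(2)] by blast
  then have l: "l \<in> pg" "P \<in> perp l" "Q \<in> perp l" using pg3 perp_sym perp_in_pg by blast+
  obtain m where "perp P \<inter> perp R = {m}" using join_unique[OF pg3(1,3) PQR(4)] by blast
  then have m: "m \<in> pg" "P \<in> perp m" "R \<in> perp m" using pg3 perp_sym perp_in_pg by blast+
  have "11 \<le> dl l" using heavy[OF l, of R] PQR by simp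
  moreover have "11 \<le> dl m" using heavy[OF m, of Q] PQR by (simp add: insert_commute)
  \<comment> \<open>If the three empty classes were collinear, their line would have
    \<open>dl\<close> at least 12.\<close>
  moreover have "l \<noteq> m"
  proof
    assume "l = m"
    then have "(\<Sum>x\<in>{P, Q, R}. d x) \<le> dl l" unfolding dl_def using l m by (intro sum_mono2) auto
    then show False using dl_le_11[OF l(1)] pg3 PQR by simp
  qed
  ultimately show False using two_lines_le[OF l(1) m(1)] by simp
qed

lemma card_Os_neq_2: "card Os \<noteq> 2"
proof
  assume c2: "card Os = 2"
  have rest: "(\<Sum>x\<in>pg - Os. d x) = 7" using sum_d_not_Os c2 by simp
  have "h = k" if "h \<in> Bs" "k \<in> Bs" for h k
  proof (rule ccontr)
    assume "h \<noteq> k"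
    have hk: "h \<in> pg" "k \<in> pg" "6 \<le> dl h" "6 \<le> dl k" "perp h \<union> perp k \<subseteq> pg - Os"
      using that perp_subset by (auto simp: Bs_def Ms_def)
    obtain p where p: "p \<in> perp h" "dl h + dl k = d p + (\<Sum>x\<in>perp h \<union> perp k. d x)"
      using two_lines[OF hk(1,2) \<open>h \<noteq> k\<close>] by metis
    have "(\<Sum>x\<in>perp h \<union> perp k. d x) \<le> 7"
      unfolding rest[symmetric] using hk(5) by (intro sum_mono2) auto
    moreover have "p \<in> pg - Os" using p(1) hk(5) by blast
    then have "d p \<le> 4" using d_le_4 by blast
    ultimately show False using hk p(2) by simp
  qed
  then have "card Bs \<le> 1" using card_le_Suc0_iff_eq[of Bs] by simp
  moreover have "Os \<noteq> {}" using c2 by auto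
  \<comment> \<open>At least 12 full classes and at most one heavy line force a cost of at least
    \<open>4 * 12 - 6 = 42\<close>, while only \<open>60 - 32 = 28\<close> is available.\<close>
  ultimately show False using count_Ms count_dl sum_dl_Ms card_Zs c2 by simp
qed

lemma card_Os_neq_1: "card Os \<noteq> 1"
proof
  assume c1: "card Os = 1"
  then have "Os \<noteq> {}" by auto
  then have "4 * card As + 6 * card Bs \<le> 44" using sum_dl_Ms c1 count_dl by simp
  moreover have "2 * card Zs \<le> card As + 3 * card Bs" "card Zs \<le> card As" "9 \<le> card Zs"
    using count_Ms count_As card_Zs c1 by simp_all
  \<comment> \<open>The cost is \<open>2 * (card As + 3 * card Bs) + 2 * card As >= 6 * card Zs >=
    54\<close>.\<close>
  ultimately show False by linarith
qed

text \<open>Without empty classes the cost is at least \<open>10 * card Zs\<close>, so there are 6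
  or 7 full classes. Then nearly all other classes have \<open>d = 1\<close>, which keeps
  \<open>dl\<close> at most 5 on lines through a full class and excludes heavy lines. Now the cost
  is at least \<open>12 * card Zs\<close>, so there are exactly 6 full classes, and all other
  classes have \<open>d = 1\<close>. By \<open>one_dl\<close> some line has \<open>dl >= 5\<close>;
  it contains no full class, so it is not among the at least 18 light lines, and
  \<open>18 * 4 + 5 > 75\<close>.\<close>

lemma Os_nonempty: "Os \<noteq> {}"
proof
  assume "Os = {}"
  then have Ms: "Ms = pg" and c0: "card Os = 0" by (auto simp: Ms_def)
  have "(\<Sum>h\<in>pg. dl h) = (\<Sum>x\<in>pg. d x * card (perp x \<inter> pg))" unfolding dl_def by (rule lines_sum) simp
  also have "\<dots> = (\<Sum>x\<in>pg. d x * 5)"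
    using perp_subset by (intro sum.cong refl) (simp add: Int_absorb2 card_perp)
  finally have sum75: "(\<Sum>h\<in>pg. dl h) = 75" using sum_d by (simp add: sum_distrib_right[symmetric])
  then have AB75: "4 * card As + 6 * card Bs \<le> 75" using count_dl Ms by simp
  have Z: "3 * card Zs \<le> card As + 3 * card Bs" "2 * card Zs \<le> card As" "6 \<le> card Zs"
    using count_Ms count_As card_Zs c0 by simp_all
  then have Z7: "card Zs \<le> 7" using AB75 by linarith
  have "card {x \<in> pg. d x \<noteq> 0} + card Zs = 21"
    unfolding Zs_def card_pg[symmetric] by (subst card_Un_disjoint[symmetric]) (auto intro: arg_cong[where f=card])
  \<comment> \<open>Subtraction is truncated: \<open>d x - 1\<close> is the excess over 1, and 0 for
    full classes.\<close>
  moreover have "(\<Sum>x\<in>pg. d x) = (\<Sum>x\<in>pg. (d x - 1) + (if d x \<noteq> 0 then 1 else 0))"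
    by (intro sum.cong refl) simp
  then have "15 = (\<Sum>x\<in>pg. d x - 1) + card {x \<in> pg. d x \<noteq> 0}"
    by (simp add: sum_d sum.distrib sum.If_cases Int_def)
  ultimately have excess: "(\<Sum>x\<in>pg. d x - 1) + 6 = card Zs" by linarith
  have dl_zero: "dl h \<le> 4 + (card Zs - 6)" if "x \<in> perp h" "d x = 0" "h \<in> pg" for h x
  proof -
    have "dl h = (\<Sum>y\<in>perp h - {x}. d y)" using dl_remove[OF that(1)] that(2) by simp
    also have "\<dots> \<le> (\<Sum>y\<in>perp h - {x}. 1 + (d y - 1))" by (intro sum_mono) simp
    also have "\<dots> = 4 + (\<Sum>y\<in>perp h - {x}. d y - 1)"
      using card_perp[OF that(3)] that(1) by (simp only: sum.distrib) simp
    also have "(\<Sum>y\<in>perp h - {x}. d y - 1) \<le> (\<Sum>x\<in>pg. d x - 1)"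
      using perp_subset by (intro sum_mono2) auto
    finally show ?thesis using excess by simp
  qed
  have "Bs = {}"
  proof (rule ccontr)
    assume "Bs \<noteq> {}"
    then obtain h x where "h \<in> pg" "6 \<le> dl h" "D h x" by (auto simp: Bs_def Ms_def)
    then show False using dl_zero[of x h] D_imp[of h x] Z7 by simp
  qed
  then have Z6: "card Zs = 6" "18 \<le> card As" using AB75 Z by simp_all
  then have "(\<Sum>x\<in>pg. d x - 1) = 0" using excess by simp
  then have le1: "d x \<le> 1" if "x \<in> pg" for x using that by simp
  have "(\<Sum>x\<in>pg. d x) \<noteq> 0" using sum_d by simp
  then obtain x where x: "x \<in> pg" "d x \<noteq> 0" by (metis sum.neutral)
  then have "d x = 1" using le1[of x] by simp
  then obtain h where h: "h \<in> perp x" "5 \<le> dl h" using one_dl[OF x(1)] by blast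
  have "h \<notin> As"
  proof
    assume "h \<in> As"
    then obtain y where "h \<in> pg" "D h y" by (auto simp: As_def Ms_def)
    then show False using dl_zero[of y h] D_imp[of h y] h Z6 by simp
  qed
  have "(\<Sum>k\<in>As. 4) \<le> (\<Sum>k\<in>As. dl k)" by (intro sum_mono) (auto simp: As_def intro: D_dl)
  moreover have "(\<Sum>k\<in>insert h As. dl k) \<le> (\<Sum>k\<in>pg. dl k)"
    using h perp_in_pg by (intro sum_mono2) (auto simp: As_def Ms_def)
  ultimately show False using sum75 h Z6 \<open>h \<notin> As\<close> by simp
qed

lemma contradiction: False
proof -
  have "card Os \<noteq> 0" using Os_nonempty by simp
  moreover have "card Os \<le> 3" using sum_d_not_Os by linarith
  ultimately consider "card Os = 1" | "card Os = 2" | "card Os = 3" by linarith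
  then show False using card_Os_neq_1 card_Os_neq_2 card_Os_neq_3 by cases auto
qed

end

section \<open>The field with four elements and its projective plane\<close>

datatype f4 = F0 | F1 | F2 | F3

lemma UNIV_f4: "UNIV = {F0,F1,F2,F3}" using f4.exhaust by auto

instance f4 :: finite by standard (simp add: UNIV_f4)

lemma ex_f4: "(\<exists>x. P x) \<longleftrightarrow> P F0 \<or> P F1 \<or> P F2 \<or> P F3" by (metis f4.exhaust)

fun f4_plus :: "f4 \<Rightarrow> f4 \<Rightarrow> f4" where
  "f4_plus F0 b = b" | "f4_plus a F0 = a"
| "f4_plus F1 F1 = F0" | "f4_plus F2 F2 = F0" | "f4_plus F3 F3 = F0"
| "f4_plus F1 F2 = F3" | "f4_plus F2 F1 = F3" 
| "f4_plus F1 F3 = F2" | "f4_plus F3 F1 = F2" | "f4_plus F2 F3 = F1" | "f4_plus F3 F2 = F1"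

fun f4_times :: "f4 \<Rightarrow> f4 \<Rightarrow> f4" where
  "f4_times F0 b = F0" | "f4_times a F0 = F0" | "f4_times F1 b = b" | "f4_times a F1 = a"
| "f4_times F2 F2 = F3" | "f4_times F2 F3 = F1" | "f4_times F3 F2 = F1" | "f4_times F3 F3 = F2"

fun f4_inverse :: "f4 \<Rightarrow> f4" where
  "f4_inverse F0 = F0" | "f4_inverse F1 = F1" | "f4_inverse F2 = F3" | "f4_inverse F3 = F2"

instantiation f4 :: field
begin

definition "0 = F0"
definition "1 = F1"
definition "(a::f4) + b = f4_plus a b"
definition "(a::f4) - b = f4_plus a b"
definition "- (a::f4) = a"
definition "(a::f4) * b = f4_times a b"
definition "inverse (a::f4) = f4_inverse a"
definition "(a::f4) div b = f4_times a (f4_inverse b)"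

instance
proof
  fix a b c :: f4
  show "a * b * c = a * (b * c)" by (cases a; cases b; cases c; simp add: times_f4_def)
  show "a * b = b * a" by (cases a; cases b; simp add: times_f4_def)
  show "1 * a = a" by (cases a; simp add: times_f4_def one_f4_def)
  show "a + b + c = a + (b + c)" by (cases a; cases b; cases c; simp add: plus_f4_def)
  show "a + b = b + a" by (cases a; cases b; simp add: plus_f4_def)
  show "0 + a = a" by (cases a; simp add: plus_f4_def zero_f4_def)
  show "- a + a = 0" by (cases a; simp add: plus_f4_def uminus_f4_def zero_f4_def)
  show "a - b = a + - b" by (cases a; cases b; simp add: plus_f4_def uminus_f4_def minus_f4_def)
  show "(a + b) * c = a * c + b * c" by (cases a; cases b; cases c; simp add: plus_f4_def times_f4_def)
  show "(0::f4) \<noteq> 1" by (simp add: zero_f4_def one_f4_def)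
  show "a \<noteq> 0 \<Longrightarrow> inverse a * a = 1" by (cases a; simp add: times_f4_def zero_f4_def one_f4_def inverse_f4_def)
  show "a div b = a * inverse b" by (simp add: divide_f4_def times_f4_def inverse_f4_def)
  show "inverse (0::f4) = 0" by (simp add: inverse_f4_def zero_f4_def)
qed

end

lemmas f4_defs = zero_f4_def one_f4_def plus_f4_def minus_f4_def uminus_f4_def times_f4_def
  inverse_f4_def divide_f4_def

lemma card_f4 [simp]: "card (UNIV :: f4 set) = 4" by (simp add: UNIV_f4)

lemma bij_affine: "p \<noteq> 0 \<Longrightarrow> bij (\<lambda>t. c + t * p)" for p c :: f4
proof -
  assume "p \<noteq> 0"
  then have "inj (\<lambda>t. c + t * p)" by (simp add: inj_def)
  then show ?thesis by (simp add: bij_def finite_UNIV_inj_surj)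
qed

lemma card_off_diagonal:
  assumes "finite A" shows "card {(P,Q) \<in> A \<times> A. P \<noteq> Q} = card A * (card A - 1)"
proof -
  have "{(P,Q) \<in> A \<times> A. P \<noteq> Q} = A \<times> A - (\<lambda>P. (P,P)) ` A" by auto
  moreover have "card ((\<lambda>P. (P,P)) ` A) = card A" by (intro card_image) (auto simp: inj_on_def)
  moreover have "card (A \<times> A - (\<lambda>P. (P,P)) ` A) = card (A \<times> A) - card ((\<lambda>P. (P,P)) ` A)"
    using assms by (intro card_Diff_subset) auto
  ultimately show ?thesis by (simp add: card_cartesian_product diff_mult_distrib2)
qed

type_synonym v3 = "f4 \<times> f4 \<times> f4"

fun dot :: "v3 \<Rightarrow> v3 \<Rightarrow> f4" where "dot (a,b,c) (x,y,z) = a*x + b*y + c*z"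

fun axpy :: "f4 \<Rightarrow> v3 \<Rightarrow> f4 \<Rightarrow> v3 \<Rightarrow> v3" where
  "axpy s (a,b,c) t (x,y,z) = (s*a + t*x, s*b + t*y, s*c + t*z)"

text \<open>Representatives with leading coordinate 1, kept as a list so that the incidence axioms
  can be evaluated.\<close>

definition pgl :: "v3 list" where
  "pgl = [(F1,a,b). a \<leftarrow> [F0,F1,F2,F3], b \<leftarrow> [F0,F1,F2,F3]] @ [(F0,F1,b). b \<leftarrow> [F0,F1,F2,F3]] @ [(F0,F0,F1)]"

definition pg :: "v3 set" where "pg = set pgl"

definition perp :: "v3 \<Rightarrow> v3 set" where "perp h = {x \<in> pg. dot h x = 0}"

lemma dot_commute: "dot x y = dot y x"
  by (cases x; cases y) (simp add: mult.commute)

lemma dot_axpy: "dot (axpy s u t v) x = s * dot u x + t * dot v x"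
  by (cases u; cases v; cases x) (simp add: algebra_simps)

interpretation polar_plane pg perp
proof
  show "finite pg" by (simp add: pg_def)
  show "card pg = 21" unfolding pg_def by code_simp
  show "perp h \<subseteq> pg" for h by (auto simp: perp_def)
  show "x \<in> pg \<Longrightarrow> h \<in> perp x \<Longrightarrow> x \<in> perp h" for x h
    by (simp add: perp_def dot_commute[of h])
  show "card (perp h) = 5" if "h \<in> pg" for h
  proof -
    have "\<forall>h\<in>set pgl. card (set (filter (\<lambda>x. dot h x = 0) pgl)) = 5" by code_simp
    then show ?thesis using that by (simp add: pg_def perp_def)
  qed
  show "\<exists>h. perp x \<inter> perp y = {h}" if "x \<in> pg" "y \<in> pg" "x \<noteq> y" for x y
  proof -
    have "\<forall>x\<in>set pgl. \<forall>y\<in>set pgl. x \<noteq> y \<longrightarrow> length (filter (\<lambda>h. dot x h = 0 \<and> dot y h = 0) pgl) = 1"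
      by code_simp
    then have "length (filter (\<lambda>h. dot x h = 0 \<and> dot y h = 0) pgl) = 1"
      using that by (simp add: pg_def)
    then obtain h where h: "filter (\<lambda>h. dot x h = 0 \<and> dot y h = 0) pgl = [h]"
      by (auto simp: length_Suc_conv)
    have "perp x \<inter> perp y = set (filter (\<lambda>h. dot x h = 0 \<and> dot y h = 0) pgl)"
      by (auto simp: perp_def pg_def)
    then have "perp x \<inter> perp y = {h}" using h by simp
    then show ?thesis ..
  qed
qed

lemma zero_notin_pg: "(0,0,0) \<notin> pg"
  by (simp add: pg_def pgl_def f4_defs)

lemma scale_to_pg:
  assumes "(a,b,c) \<noteq> (0,0,0)" obtains k where "k \<noteq> 0" "(a*k,b*k,c*k) \<in> pg"
proof -
  have mem: "(1,p,q) \<in> pg" "(0,1,p) \<in> pg" "(0,0,1) \<in> pg" for p q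
    by (cases p; cases q; simp add: pg_def pgl_def f4_defs)+
  consider "a \<noteq> 0" | "a = 0" "b \<noteq> 0" | "a = 0" "b = 0" "c \<noteq> 0" using assms by auto
  then show thesis
  proof cases
    case 1 then show thesis using mem(1) by (intro that[of "inverse a"]) simp_all
  next
    case 2 then show thesis using mem(2) by (intro that[of "inverse b"]) simp_all
  next
    case 3 then show thesis using mem(3) by (intro that[of "inverse c"]) simp_all
  qed
qed

lemma dot_eq_0_scale:
  assumes "e \<noteq> (0,0,0)" shows "\<exists>h\<in>pg. \<forall>x. dot h x = 0 \<longleftrightarrow> dot e x = 0"
proof -
  obtain a b c where e: "e = (a,b,c)" by (cases e) auto
  obtain k where k: "k \<noteq> 0" "(a*k,b*k,c*k) \<in> pg" using scale_to_pg assms e by metis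
  have "dot (a*k,b*k,c*k) x = k * dot e x" for x unfolding e by (cases x) (simp add: algebra_simps)
  then show ?thesis using k by (intro bexI[OF _ k(2)]) simp
qed

text \<open>Applied with \<open>e\<close> the radical difference of two points in the class
  \<open>x\<close>; then \<open>h\<close> is a direction in which they share a segment. The cases
  \<open>e = 0\<close> and \<open>e\<close> proportional to \<open>x\<close> leave a choice of
  \<open>h\<close>.\<close>

lemma common_perp:
  assumes x: "x \<in> pg" obtains h where "h \<in> pg" "dot h x = 0" "dot h e = 0"
proof (cases "e = (0,0,0)")
  case True
  have "perp x \<noteq> {}" using card_perp[OF x] by auto
  then obtain h where "h \<in> perp x" by blast
  moreover have "dot h e = 0" using True by (cases h) simp
  ultimately show thesis using that[of h] by (simp add: perp_def dot_commute[of x])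
next
  case False
  then obtain y where y: "y \<in> pg" "\<And>w. dot y w = 0 \<longleftrightarrow> dot e w = 0" using dot_eq_0_scale by blast
  have "perp x \<inter> perp y \<noteq> {}"
  proof (cases "x = y")
    case True then show ?thesis using card_perp[OF x] by auto
  next
    case False then show ?thesis using join_unique[OF x y(1)] by auto
  qed
  then obtain h where "h \<in> perp x" "h \<in> perp y" by blast
  then show thesis using y that[of h] by (simp add: perp_def dot_commute[of x] dot_commute[of e])
qed

text \<open>Take \<open>e\<close> as another line through \<open>x\<close>. Adding multiples of
  \<open>e\<close> to the index of a line in the class \<open>h\<close> keeps its segment at
  \<open>x\<close> and moves all its other segments.\<close>

lemma transversal_line:
  assumes "h \<in> pg" "x \<in> perp h"
  obtains e where "dot e x = 0" "\<And>y. y \<in> perp h \<Longrightarrow> y \<noteq> x \<Longrightarrow> dot e y \<noteq> 0"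
proof -
  have x: "x \<in> pg" using assms perp_subset by blast
  have "\<not> perp x \<subseteq> {h}"
    using card_perp[OF x] card_mono[of "{h}" "perp x"] by auto
  then obtain e where e: "e \<in> perp x" "e \<noteq> h" by blast
  show thesis
  proof
    show "dot e x = 0" using e by (simp add: perp_def dot_commute[of e])
    show "dot e y \<noteq> 0" if "y \<in> perp h" "y \<noteq> x" for y
    proof
      assume "dot e y = 0"
      then have "e = h" using join_eq[of x y e h] e that assms x
        by (simp add: perp_def dot_commute[of y] dot_commute[of x])
      then show False using e by simp
    qed
  qed
qed

text \<open>The 16 lines of the class \<open>h\<close> get as coordinates their segments at
  \<open>x\<close> and at \<open>y\<close>. At a third class the segment is an affine function of
  \<open>s + l * t\<close>, and different classes have different slopes \<open>l\<close>. There are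
  three classes left and three nonzero slopes, so every slope occurs once.\<close>

lemma grid_coordinates:
  assumes h: "h \<in> pg" and x: "x \<in> perp h" and y: "y \<in> perp h" and "x \<noteq> y"
    and X: "X1 \<noteq> X2" and Y: "Y1 \<noteq> Y2"
  obtains G c p z where "\<And>s t. dot (G s t) x = X1 + s * (X2 - X1)" "\<And>s t. dot (G s t) y = Y1 + t * (Y2 - Y1)"
    "bij_betw z (UNIV - {0}) (perp h - {x, y})" "\<And>l. l \<noteq> 0 \<Longrightarrow> p l \<noteq> 0"
    "\<And>s t l. l \<noteq> 0 \<Longrightarrow> dot (G s t) (z l) = c l + (s + l * t) * p l"
proof -
  have pgs: "x \<in> pg" "y \<in> pg" using x y perp_subset by blast+
  obtain u where u: "dot u x = 0" "\<And>z. z \<in> perp h \<Longrightarrow> z \<noteq> x \<Longrightarrow> dot u z \<noteq> 0"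
    using transversal_line[OF h x] by metis
  obtain v where v: "dot v y = 0" "\<And>z. z \<in> perp h \<Longrightarrow> z \<noteq> y \<Longrightarrow> dot v z \<noteq> 0"
    using transversal_line[OF h y] by metis
  define k where "k = (X2 - X1) / dot v x"
  define m where "m = (Y2 - Y1) / dot u y"
  have ne: "dot v x \<noteq> 0" "dot u y \<noteq> 0" using u v x y \<open>x \<noteq> y\<close> by metis+
  then have km: "k \<noteq> 0" "m \<noteq> 0" using X Y by (simp_all add: k_def m_def)
  define G where "G s t = axpy (X1 / dot v x + s * k) v (Y1 / dot u y + t * m) u" for s t
  \<comment> \<open>The ratio of the coefficients of \<open>t\<close> and \<open>s\<close> in
    \<open>dot (G s t) z\<close>.\<close>
  define q where "q z = (m * dot u z) / (k * dot v z)" for z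
  have q0: "q z \<noteq> 0" if "z \<in> perp h - {x, y}" for z
    using that u v km by (simp add: q_def)
  have inj: "inj_on q (perp h - {x, y})"
  proof (rule inj_onI, rule ccontr)
    fix z z' assume z: "z \<in> perp h - {x, y}" "z' \<in> perp h - {x, y}" "q z = q z'" "z \<noteq> z'"
    have d: "dot v z \<noteq> 0" "dot v z' \<noteq> 0" "dot u z \<noteq> 0" using z u v by auto
    have e: "dot u z * dot v z' = dot u z' * dot v z"
      using z(3) d km by (simp add: q_def field_simps)
    \<comment> \<open>Equal slopes at \<open>z\<close> and \<open>z'\<close> make \<open>e\<close>
      vanish at both. So \<open>e\<close> represents their join \<open>h\<close>, which is
      impossible because \<open>e\<close> does not vanish at \<open>x\<close>.\<close>
    define e where "e = axpy (dot v z) u (- dot u z) v"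
    have de: "dot e w = dot v z * dot u w - dot u z * dot v w" for w
      by (simp add: e_def dot_axpy)
    have "dot e z = 0" "dot e z' = 0" using \<open>dot u z * dot v z' = dot u z' * dot v z\<close>
      by (simp_all add: de mult.commute)
    have ex: "dot e x \<noteq> 0" using d ne by (simp add: de u(1))
    then have "e \<noteq> (0,0,0)" by (cases x) auto
    then obtain h' where h': "h' \<in> pg" "\<And>w. dot h' w = 0 \<longleftrightarrow> dot e w = 0"
      using dot_eq_0_scale by blast
    have zz: "z \<in> pg" "z' \<in> pg" using z perp_subset by blast+
    have "h' \<in> perp z" "h' \<in> perp z'" "h \<in> perp z" "h \<in> perp z'"
      using h' h z \<open>dot e z = 0\<close> \<open>dot e z' = 0\<close> zz by (auto simp: perp_def dot_commute[of z] dot_commute[of z'])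
    then have "h' = h" using join_eq[OF zz z(4)] by blast
    then show False using h'(2)[of x] ex x by (simp add: perp_def)
  qed
  have "perp h - {x, y} = perp h - {x} - {y}" by blast
  then have c3: "card (perp h - {x, y}) = 3" using card_perp[OF h] x y \<open>x \<noteq> y\<close> by simp
  have "card (UNIV - {0::f4}) = 3" by simp
  then have "q ` (perp h - {x, y}) = UNIV - {0}"
    using q0 c3 card_image[OF inj] by (intro card_subset_eq) auto
  then have bij: "bij_betw q (perp h - {x, y}) (UNIV - {0})" using inj by (simp add: bij_betw_def)
  define z where "z = inv_into (perp h - {x, y}) q"
  have zb: "bij_betw z (UNIV - {0}) (perp h - {x, y})"
    unfolding z_def by (rule bij_betw_inv_into[OF bij])
  have zin: "z l \<in> perp h - {x, y}" if "l \<noteq> 0" for l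
    using bij_betwE[OF zb] that by simp
  have qz: "q (z l) = l" if "l \<noteq> 0" for l
    unfolding z_def using bij_betw_inv_into_right[OF bij] that by simp
  define c where "c l = X1 / dot v x * dot v (z l) + Y1 / dot u y * dot u (z l)" for l
  show thesis
  proof (rule that[of G z "\<lambda>l. k * dot v (z l)" c])
    show "dot (G s t) x = X1 + s * (X2 - X1)" for s t
      using ne u(1) by (simp add: G_def dot_axpy k_def field_simps)
    show "dot (G s t) y = Y1 + t * (Y2 - Y1)" for s t
      using ne v(1) by (simp add: G_def dot_axpy m_def field_simps)
    show "bij_betw z (UNIV - {0}) (perp h - {x, y})" by (rule zb)
    show kl: "k * dot v (z l) \<noteq> 0" if "l \<noteq> 0" for l using zin[OF that] km v by auto
    show "dot (G s t) (z l) = c l + (s + l * t) * (k * dot v (z l))" if "l \<noteq> 0" for s t l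
    proof -
      have "m * dot u (z l) = l * (k * dot v (z l))" using qz[OF that] kl[OF that] by (simp add: q_def field_simps)
      then have "t * m * dot u (z l) = t * (l * (k * dot v (z l)))" by (simp only: mult.assoc)
      then show ?thesis by (simp add: G_def dot_axpy c_def algebra_simps)
    qed
  qed
qed

section \<open>The weights of the neighbour classes\<close>

text \<open>In coordinates \<open>(s,t)\<close> for the lines of a line class in which two classes are double at
  \<open>s \<in> {0,1}\<close> and \<open>t \<in> {0,1}\<close>, the numbers \<open>a, b, c\<close> count the points of the other three classes
  in the segments \<open>s + t\<close>, \<open>s + \<omega>t\<close>, \<open>s + \<omega>\<^sup>2t\<close>.\<close>

lemma two_doubles_grid_bound:
  fixes a0 a1 a2 a3 b0 b1 b2 b3 c0 c1 c2 c3 :: nat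
  assumes i: "a0+b0+c0\<le>1" "a1+b1+c1\<le>1" "a1+b2+c3\<le>1" "a0+b3+c2\<le>1"
    and m: "a2+b2+c2\<le>3" "a2+b1+c0\<le>3" "a2+b3+c1\<le>3" "a2+b0+c3\<le>3"
    and n: "a3+b3+c3\<le>3" "a3+b0+c1\<le>3" "a3+b2+c0\<le>3" "a3+b1+c2\<le>3"
    and b: "1 \<le> b0+b1+b2+b3" and c: "1 \<le> c0+c1+c2+c3" and a: "a0+a1+a2+a3\<le>4"
  shows "(a0+a1+a2+a3)+(b0+b1+b2+b3)+(c0+c1+c2+c3)\<le>6"
proof (rule ccontr)
  assume neg: "\<not> ?thesis"
  define S where "S = (b0+b1+b2+b3)+(c0+c1+c2+c3)"
  \<comment> \<open>The four cells of \<open>i\<close> contain each of \<open>a0\<close>,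
    \<open>a1\<close> twice and every \<open>b\<close> and \<open>c\<close> once. A total of 7 with
    at most 4 from \<open>a\<close> gives \<open>3 \<le> S\<close>, which forces
    \<open>a0 = a1 = 0\<close>.\<close>
  have 1: "2*(a0+a1) + S \<le> 4" unfolding S_def using i by simp
  have 2: "7 \<le> a0+a1+a2+a3 + S" unfolding S_def using neg by simp
  have a01: "a0 = 0" "a1 = 0" and a23: "3 \<le> a2 + a3" using 1 2 a by auto
  have 4: "4*a2 + S \<le> 12" "4*a3 + S \<le> 12" unfolding S_def using m n by simp_all
  have S: "3 \<le> S" "S \<le> 4" using 1 2 a by auto
  have bb: "1 \<le> b0 \<or> 1 \<le> b1 \<or> 1 \<le> b2 \<or> 1 \<le> b3" using b by auto
  note i = i[unfolded a01, simplified]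
  \<comment> \<open>Four cells of bound 1 that together exhaust \<open>S = 4\<close> are all equal
    to 1. Two such systems pair every \<open>b\<close> with two different \<open>c\<close>, so
    \<open>b\<close> and \<open>c\<close> are constant.\<close>
  have mm: "b0 = b1 \<and> b1 = b2 \<and> b2 = b3 \<and> c0 = c1 \<and> c1 = c2 \<and> c2 = c3" if "S = 4"
    "b2+c2\<le>1" "b1+c0\<le>1" "b3+c1\<le>1" "b0+c3\<le>1"
  proof -
    have "b0 + c0 = 1" "b1 + c1 = 1" "b2 + c3 = 1" "b3 + c2 = 1" using i that(1) unfolding S_def by linarith+
    moreover have "b2+c2=1" "b1+c0=1" "b3+c1=1" "b0+c3=1" using that unfolding S_def by linarith+
    ultimately show ?thesis by linarith
  qed
  have "a2 \<le> 2" "a3 \<le> 2" using 4 S by auto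
  then consider "a2 = 2" "a3 = 2" | "a2 = 2" "a3 = 1" | "a2 = 1" "a3 = 2" using a23 by linarith
  then show False
  proof cases
    \<comment> \<open>All twelve cells now leave at most 1 for \<open>b\<close> and
      \<open>c\<close>. A nonzero \<open>b\<close> kills three of the \<open>c\<close>; the
      surviving \<open>c\<close> kills the other three \<open>b\<close>; hence
      \<open>S \<le> 2\<close>.\<close>
    case 1
    note m = m[unfolded 1, simplified] and n = n[unfolded 1, simplified]
    from bb S(1) show False
    proof (elim disjE)
      assume "1 \<le> b0"
      then have "c0 = 0" "c1 = 0" "c3 = 0" using i m n by auto
      then have "1 \<le> c2" using c by simp
      then have "b1 = 0" "b2 = 0" "b3 = 0" using i m n by auto
      then show False using S \<open>c0 = 0\<close> \<open>c1 = 0\<close> \<open>c3 = 0\<close> \<open>1 \<le> c2\<close> i m n unfolding S_def by simp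
    next
      assume "1 \<le> b1"
      then have "c0 = 0" "c1 = 0" "c2 = 0" using i m n by auto
      then have "1 \<le> c3" using c by simp
      then have "b0 = 0" "b2 = 0" "b3 = 0" using i m n by auto
      then show False using S \<open>c0 = 0\<close> \<open>c1 = 0\<close> \<open>c2 = 0\<close> \<open>1 \<le> c3\<close> i m n unfolding S_def by simp
    next
      assume "1 \<le> b2"
      then have "c0 = 0" "c2 = 0" "c3 = 0" using i m n by auto
      then have "1 \<le> c1" using c by simp
      then have "b1 = 0" "b0 = 0" "b3 = 0" using i m n by auto
      then show False using S \<open>c0 = 0\<close> \<open>c2 = 0\<close> \<open>c3 = 0\<close> \<open>1 \<le> c1\<close> i m n unfolding S_def by simp
    next
      assume "1 \<le> b3"
      then have "c2 = 0" "c1 = 0" "c3 = 0" using i m n by auto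
      then have "1 \<le> c0" using c by simp
      then have "b1 = 0" "b2 = 0" "b0 = 0" using i m n by auto
      then show False using S \<open>c2 = 0\<close> \<open>c1 = 0\<close> \<open>c3 = 0\<close> \<open>1 \<le> c0\<close> i m n unfolding S_def by simp
    qed
  next
    \<comment> \<open>Here \<open>S = 4\<close>, so \<open>b\<close> and \<open>c\<close> are
      constant with sum 1, and one of the two classes would be empty.\<close>
    case 2
    have "S = 4" using S \<open>7 \<le> a0+a1+a2+a3 + S\<close> 2 a01 by simp
    then have "b0 = b1 \<and> b1 = b2 \<and> b2 = b3 \<and> c0 = c1 \<and> c1 = c2 \<and> c2 = c3" using mm m 2 by simp
    moreover have "b0 = 0 \<or> c0 = 0" using i(1) by linarith
    ultimately show False using b c by auto
  next
    case 3
    have S4: "S = 4" using S \<open>7 \<le> a0+a1+a2+a3 + S\<close> 3 a01 by simp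
    note n = n[unfolded 3, simplified]
    have "b0 + c0 = 1" "b1 + c1 = 1" "b2 + c3 = 1" "b3 + c2 = 1" using i S4 unfolding S_def by linarith+
    moreover have "b3+c3=1" "b0+c1=1" "b2+c0=1" "b1+c2=1" using n S4 unfolding S_def by linarith+
    ultimately have "b1 = b0 \<and> b2 = b0 \<and> b3 = b0 \<and> c1 = c0 \<and> c2 = c0 \<and> c3 = c0" by linarith
    moreover have "b0 = 0 \<or> c0 = 0" using i(1) by linarith
    ultimately show False using b c by auto
  qed
qed

text \<open>\<open>cl P\<close> is the neighbour class of \<open>P\<close> and \<open>seg P h\<close> the segment of that class, in the direction of
  the line class \<open>h\<close>, that contains \<open>P\<close>. The lines of the class \<open>h\<close> are indexed, with repetitions, by
  the vectors \<open>g\<close>.\<close>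

locale residual_arc =
  fixes K :: "'p set" and cl :: "'p \<Rightarrow> v3" and seg :: "'p \<Rightarrow> v3 \<Rightarrow> f4"
  assumes finite_K: "finite K" and cl_pg: "P \<in> K \<Longrightarrow> cl P \<in> pg"
    and cover: "h \<in> pg \<Longrightarrow> card {P \<in> K. dot h (cl P) = 0 \<and> dot g (cl P) = seg P h} \<le> 5"
    and same_seg: "\<lbrakk>P \<in> K; Q \<in> K; cl P = cl Q\<rbrakk> \<Longrightarrow> \<exists>h\<in>pg. dot h (cl P) = 0 \<and> seg P h = seg Q h"
    and card_K: "card K = 69"
begin

definition wt :: "v3 \<Rightarrow> nat" where "wt x = card {P \<in> K. cl P = x}"

definition mul :: "v3 \<Rightarrow> v3 \<Rightarrow> f4 \<Rightarrow> nat" where "mul h x s = card {P \<in> K. cl P = x \<and> seg P h = s}"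

definition lwt :: "v3 \<Rightarrow> nat" where "lwt h = (\<Sum>x\<in>perp h. wt x)"

definition double :: "v3 \<Rightarrow> v3 \<Rightarrow> bool" where
  "double h x \<longleftrightarrow> wt x = 4 \<and> (\<forall>s. mul h x s = 0 \<or> mul h x s = 2)"

lemma sum_mul: "(\<Sum>s\<in>UNIV. mul h x s) = wt x"
proof -
  have "card (\<Union>s\<in>UNIV. {P \<in> K. cl P = x \<and> seg P h = s}) = (\<Sum>s\<in>UNIV. mul h x s)"
    unfolding mul_def using finite_K by (intro card_UN_disjoint) auto
  also have "(\<Union>s\<in>UNIV. {P \<in> K. cl P = x \<and> seg P h = s}) = {P \<in> K. cl P = x}" by blast
  finally show ?thesis by (simp add: wt_def)
qed

lemma sum_mul_bij: "bij f \<Longrightarrow> (\<Sum>t\<in>UNIV. mul h x (f t)) = wt x"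
  using sum.reindex_bij_betw[of f UNIV UNIV "mul h x"] by (simp add: sum_mul)

lemma sum_wt: "(\<Sum>x\<in>pg. wt x) = 69"
proof -
  have "card (\<Union>x\<in>pg. {P \<in> K. cl P = x}) = (\<Sum>x\<in>pg. wt x)"
    unfolding wt_def using finite_K by (intro card_UN_disjoint) auto
  also have "(\<Union>x\<in>pg. {P \<in> K. cl P = x}) = K" using cl_pg by blast
  finally show ?thesis by (simp add: card_K)
qed

lemma cover_sum:
  assumes "h \<in> pg" shows "(\<Sum>x\<in>perp h. mul h x (dot g x)) \<le> 5"
proof -
  have "card (\<Union>x\<in>perp h. {P \<in> K. cl P = x \<and> seg P h = dot g x}) = (\<Sum>x\<in>perp h. mul h x (dot g x))"
    unfolding mul_def using finite_K by (intro card_UN_disjoint) auto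
  also have "(\<Union>x\<in>perp h. {P \<in> K. cl P = x \<and> seg P h = dot g x}) =
      {P \<in> K. dot h (cl P) = 0 \<and> dot g (cl P) = seg P h}"
    unfolding perp_def using cl_pg by fastforce
  finally show ?thesis using cover[OF assms, of g] by simp
qed

text \<open>The four lines of the class \<open>h\<close> through the segment \<open>s\<close> of
  \<open>x\<close>. Bijectivity says that they partition every other class on
  \<open>h\<close>.\<close>

lemma row:
  assumes h: "h \<in> pg" and x: "x \<in> perp h"
  obtains g where "\<And>t. dot (g t) x = s" "\<And>y. y \<in> perp h \<Longrightarrow> y \<noteq> x \<Longrightarrow> bij (\<lambda>t::f4. dot (g t) y)"
proof -
  obtain e where e: "dot e x = 0" "\<And>y. y \<in> perp h \<Longrightarrow> y \<noteq> x \<Longrightarrow> dot e y \<noteq> 0"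
    using transversal_line[OF h x] by metis
  have "x \<in> pg" using x perp_subset by blast
  then have "\<not> perp h \<subseteq> {x}" using card_perp[OF h] card_mono[of "{x}" "perp h"] by auto
  then obtain y where y: "y \<in> perp h" "y \<noteq> x" by blast
  obtain k where k: "dot k x \<noteq> 0" using transversal_line[OF h y(1)] x y by metis
  show thesis
  proof (rule that[of "\<lambda>t. axpy (s / dot k x) k t e"])
    show "dot (axpy (s / dot k x) k t e) x = s" for t using e k by (simp add: dot_axpy)
    show "bij (\<lambda>t. dot (axpy (s / dot k x) k t e) y)" if "y \<in> perp h" "y \<noteq> x" for y
      using e(2)[OF that] by (simp add: dot_axpy bij_affine)
  qed
qed

text \<open>Four lines with at most 5 points each contain the chosen segment four times and every
  point of the other classes on \<open>h\<close> once.\<close>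

lemma segment_bound:
  assumes h: "h \<in> pg" and x: "x \<in> perp h"
  shows "lwt h + 4 * mul h x s \<le> 20 + wt x"
proof -
  obtain g where g: "\<And>t. dot (g t) x = s" "\<And>y. y \<in> perp h \<Longrightarrow> y \<noteq> x \<Longrightarrow> bij (\<lambda>t::f4. dot (g t) y)"
    using row[OF h x, of s] by blast
  have "(\<Sum>t::f4\<in>UNIV. \<Sum>y\<in>perp h. mul h y (dot (g t) y)) \<le> (\<Sum>t::f4\<in>UNIV. 5)"
    by (intro sum_mono cover_sum h)
  also have "\<dots> = 20" by simp
  also have "(\<Sum>t::f4\<in>UNIV. \<Sum>y\<in>perp h. mul h y (dot (g t) y)) =
      (\<Sum>y\<in>perp h. \<Sum>t::f4\<in>UNIV. mul h y (dot (g t) y))" by (rule sum.swap)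
  also have "\<dots> = (\<Sum>t::f4\<in>UNIV. mul h x (dot (g t) x)) +
      (\<Sum>y\<in>perp h - {x}. \<Sum>t::f4\<in>UNIV. mul h y (dot (g t) y))"
    by (rule sum.remove[OF finite_perp x])
  also have "\<dots> = 4 * mul h x s + (\<Sum>y\<in>perp h - {x}. wt y)"
    using g by (simp add: sum_mul_bij)
  finally show ?thesis unfolding lwt_def using sum.remove[OF finite_perp x, of wt] by simp
qed

lemma pencil_lwt:
  assumes x: "x \<in> pg" shows "(\<Sum>h\<in>perp x. lwt h) = 69 + 4 * wt x"
proof -
  have "(\<Sum>h\<in>perp x. lwt h) = (\<Sum>h\<in>perp x. wt x + (\<Sum>y\<in>perp h - {x}. wt y))"
    unfolding lwt_def by (intro sum.cong refl sum.remove[OF finite_perp] perp_sym[OF x])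
  also have "\<dots> = 5 * wt x + (\<Sum>y\<in>pg - {x}. wt y)"
    using card_perp[OF x] pencil_sum[OF x, of wt] by (simp add: sum.distrib)
  finally show ?thesis using sum.remove[OF finite_pg x, of wt] sum_wt by simp
qed

section \<open>Distribution of the points inside one class\<close>

definition mx :: "v3 \<Rightarrow> v3 \<Rightarrow> nat" where "mx h x = Max (range (mul h x))"

lemma mul_le_mx: "mul h x s \<le> mx h x"
  unfolding mx_def by (intro Max_ge) auto

lemma mx_attained: "\<exists>s. mul h x s = mx h x"
proof -
  have "mx h x \<in> range (mul h x)" unfolding mx_def by (intro Max_in) auto
  then show ?thesis by (auto simp: image_iff)
qed

lemma wt_le_mx: "wt x \<le> 4 * mx h x"
proof -
  have "(\<Sum>s\<in>UNIV. mul h x s) \<le> (\<Sum>s::f4\<in>UNIV. mx h x)" by (intro sum_mono mul_le_mx)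
  then show ?thesis by (simp add: sum_mul)
qed

text \<open>Sum of \<open>segment_bound\<close> over the pencil: \<open>69 + 4 * wt x\<close> plus
  four times the sum of \<open>mx\<close> is at most \<open>5 * (20 + wt x)\<close>.\<close>

lemma sum_mx:
  assumes x: "x \<in> pg" shows "4 * (\<Sum>h\<in>perp x. mx h x) \<le> 31 + wt x"
proof -
  have "(\<Sum>h\<in>perp x. lwt h + 4 * mx h x) \<le> (\<Sum>h\<in>perp x. 20 + wt x)"
  proof (rule sum_mono)
    fix h assume "h \<in> perp x"
    moreover obtain s where "mul h x s = mx h x" using mx_attained by blast
    ultimately show "lwt h + 4 * mx h x \<le> 20 + wt x"
      using segment_bound[of h x s] perp_in_pg[of h x] perp_sym[OF x, of h] by simp
  qed
  then show ?thesis
    using pencil_lwt[OF x] card_perp[OF x] by (simp add: sum.distrib sum_distrib_left)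
qed

text \<open>The hypothesis says that \<open>m\<close> is at most \<open>wt x / 4\<close> rounded up,
  so the pigeonhole principle applies in each direction.\<close>

lemma sum_mx_ge:
  assumes x: "x \<in> pg" and "4 * m < wt x + 4" shows "m * 5 \<le> (\<Sum>h\<in>perp x. mx h x)"
proof -
  have "(\<Sum>h\<in>perp x. m) \<le> (\<Sum>h\<in>perp x. mx h x)"
  proof (rule sum_mono)
    fix h show "m \<le> mx h x" using assms(2) wt_le_mx[of x h] by linarith
  qed
  then show ?thesis using card_perp[OF x] by simp
qed

text \<open>The pigeonhole bound and \<open>sum_mx\<close> feed each other: weight 5 forces 9, then
  29, then 129, more than the whole arc.\<close>

lemma wt_le_4:
  assumes x: "x \<in> pg" shows "wt x \<le> 4"
proof (rule ccontr)
  assume "\<not> ?thesis"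
  then have "4 * 2 < wt x + 4" by simp
  then have "9 \<le> wt x" using sum_mx_ge[OF x, of 2] sum_mx[OF x] by linarith
  then have "4 * 3 < wt x + 4" by simp
  then have "29 \<le> wt x" using sum_mx_ge[OF x, of 3] sum_mx[OF x] by linarith
  then have "4 * 8 < wt x + 4" by simp
  then have "129 \<le> wt x" using sum_mx_ge[OF x, of 8] sum_mx[OF x] by linarith
  moreover have "wt x \<le> 69"
    using sum_wt member_le_sum[OF x, of wt] by simp
  ultimately show False by simp
qed

text \<open>By \<open>same_seg\<close>, every ordered pair of distinct points in the class is
  counted in some direction.\<close>

lemma pairs_bound:
  assumes x: "x \<in> pg"
  shows "wt x * (wt x - 1) \<le> (\<Sum>h\<in>perp x. \<Sum>s\<in>UNIV. mul h x s * (mul h x s - 1))"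
proof -
  let ?A = "{P \<in> K. cl P = x}" and ?B = "\<lambda>h s. {P \<in> K. cl P = x \<and> seg P h = s}"
  have "{(P,Q) \<in> ?A \<times> ?A. P \<noteq> Q} \<subseteq> (\<Union>h\<in>perp x. \<Union>s\<in>UNIV. {(P,Q) \<in> ?B h s \<times> ?B h s. P \<noteq> Q})"
  proof clarify
    fix P Q assume "P \<in> K" "Q \<in> K" "x = cl P" "cl Q = cl P" "P \<noteq> Q"
    moreover obtain h where "h \<in> pg" "dot h (cl P) = 0" "seg P h = seg Q h"
      using same_seg[of P Q] calculation by auto
    ultimately show "(P,Q) \<in> (\<Union>h\<in>perp (cl P). \<Union>s\<in>UNIV. {(P',Q'). (P',Q') \<in>
      {P' \<in> K. cl P' = cl P \<and> seg P' h = s} \<times> {P' \<in> K. cl P' = cl P \<and> seg P' h = s} \<and> P' \<noteq> Q'})"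
      unfolding perp_def dot_commute[of "cl P"] by blast
  qed
  then have "card {(P,Q) \<in> ?A \<times> ?A. P \<noteq> Q} \<le> card (\<Union>h\<in>perp x. \<Union>s\<in>UNIV. {(P,Q) \<in> ?B h s \<times> ?B h s. P \<noteq> Q})"
    using finite_K by (intro card_mono finite_UN_I finite_perp finite)
      (auto intro: finite_subset[of _ "K \<times> K"])
  also have "\<dots> \<le> (\<Sum>h\<in>perp x. card (\<Union>s\<in>UNIV. {(P,Q) \<in> ?B h s \<times> ?B h s. P \<noteq> Q}))"
    by (rule card_UN_le) simp
  also have "\<dots> \<le> (\<Sum>h\<in>perp x. \<Sum>s\<in>UNIV. card {(P,Q) \<in> ?B h s \<times> ?B h s. P \<noteq> Q})"
    by (intro sum_mono card_UN_le) simp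
  finally show ?thesis
    unfolding wt_def mul_def by (subst (asm) (1 2) card_off_diagonal) (use finite_K in auto)
qed

lemma double_segments:
  assumes "double h x" obtains s t where "s \<noteq> t" "mul h x s = 2" "mul h x t = 2"
proof -
  have v: "mul h x s = 0 \<or> mul h x s = 2" for s using assms by (simp add: double_def)
  have 4: "(\<Sum>s\<in>UNIV. mul h x s) = 4" using sum_mul[of h x] assms by (simp add: double_def)
  have "\<exists>s. mul h x s \<noteq> 0"
  proof (rule ccontr)
    assume "\<not> ?thesis"
    then show False using 4 by simp
  qed
  then obtain s where s: "mul h x s = 2" using v by metis
  have "(\<Sum>t\<in>UNIV - {s}. mul h x t) = 2"
    using 4 sum.remove[of UNIV s "mul h x"] s by simp
  then have "\<exists>t\<in>UNIV - {s}. mul h x t \<noteq> 0" by (metis sum.neutral zero_neq_numeral)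
  then obtain t where "t \<noteq> s" "mul h x t = 2" using v by (metis DiffD2 singletonI)
  then show thesis using that s by blast
qed

lemma double_lwt: "h \<in> pg \<Longrightarrow> x \<in> perp h \<Longrightarrow> double h x \<Longrightarrow> lwt h \<le> 16"
proof -
  assume a: "h \<in> pg" "x \<in> perp h" "double h x"
  obtain s where s: "mul h x s = 2" using double_segments[OF a(3)] by metis
  have "wt x = 4" using a(3) by (simp add: double_def)
  then show "lwt h \<le> 16" using segment_bound[OF a(1,2), of s] s by simp
qed

text \<open>With \<open>e h\<close> the number of ordered pairs sharing a segment in direction
  \<open>h\<close>, \<open>e h \<le> 4 * (mx h x - 1)\<close>. The 12 pairs and the total excess 3
  of \<open>mx\<close> force equality. So every segment has 0 or \<open>mx h x\<close> points, and
  \<open>mx h x\<close> divides 4. A value 4 gives the light line; otherwise the excess 3 comes from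
  three directions with value 2.\<close>

lemma wt_4_cases:
  assumes x: "x \<in> pg" and w: "wt x = 4"
  shows "(\<exists>h\<in>perp x. lwt h \<le> 8) \<or> 3 \<le> card {h \<in> perp x. double h x}"
proof (rule disjCI)
  assume no_light: "\<not> 3 \<le> card {h \<in> perp x. double h x}"
  define e where "e h = (\<Sum>s\<in>UNIV. mul h x s * (mul h x s - 1))" for h
  have pos: "1 \<le> mx h x" for h using wt_le_mx[of x h] w by simp
  have e_le: "e h \<le> 4 * (mx h x - 1)" for h
  proof -
    have "e h \<le> (\<Sum>s\<in>UNIV. mul h x s * (mx h x - 1))"
      unfolding e_def by (intro sum_mono mult_le_mono diff_le_mono mul_le_mx) simp
    then show ?thesis by (simp add: sum_distrib_right[symmetric] sum_mul w)
  qed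
  have "(\<Sum>h\<in>perp x. (mx h x - 1) + 1) = (\<Sum>h\<in>perp x. mx h x)"
    by (intro sum.cong refl le_add_diff_inverse2 pos)
  then have "(\<Sum>h\<in>perp x. mx h x - 1) + 5 = (\<Sum>h\<in>perp x. mx h x)"
    using card_perp[OF x] by (simp only: sum.distrib) simp
  then have le3: "(\<Sum>h\<in>perp x. mx h x - 1) \<le> 3" using sum_mx[OF x] w by linarith
  have ge12: "12 \<le> (\<Sum>h\<in>perp x. e h)" using pairs_bound[OF x] w by (simp add: e_def)
  have e_eq: "e h = 4 * (mx h x - 1)" if "h \<in> perp x" for h
  proof (rule ccontr)
    assume "e h \<noteq> 4 * (mx h x - 1)"
    then have "(\<Sum>h\<in>perp x. e h) < (\<Sum>h\<in>perp x. 4 * (mx h x - 1))"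
      using that e_le[of h] by (intro sum_strict_mono_ex1 ballI e_le bexI[of _ h]) auto
    then show False using ge12 le3 by (simp add: sum_distrib_left[symmetric])
  qed
  have val: "mul h x s = 0 \<or> mul h x s = mx h x" if "h \<in> perp x" for h s
  proof (rule ccontr)
    assume "\<not> ?thesis"
    then have "mul h x s * (mul h x s - 1) < mul h x s * (mx h x - 1)"
      using mul_le_mx[of h x s] by auto
    then have "e h < (\<Sum>s\<in>UNIV. mul h x s * (mx h x - 1))"
      unfolding e_def
      by (intro sum_strict_mono_ex1 ballI mult_le_mono diff_le_mono mul_le_mx bexI[of _ s]) auto
    then show False using e_eq[OF that] by (simp add: sum_distrib_right[symmetric] sum_mul w)
  qed
  have sum4: "mul h x F0 + mul h x F1 + mul h x F2 + mul h x F3 = 4" for h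
    using sum_mul[of h x] w by (simp add: UNIV_f4)
  have mx_cases: "mx h x = 1 \<or> double h x \<and> mx h x = 2 \<or> mx h x = 4" if "h \<in> perp x" for h
  proof -
    obtain s where "mul h x s = mx h x" using mx_attained by blast
    moreover have "mul h x s \<le> 4" using sum4[of h] by (cases s) auto
    ultimately have "mx h x \<le> 4" by simp
    moreover have "mx h x \<noteq> 3"
    proof
      assume "mx h x = 3"
      then show False
        using val[OF that, of F0] val[OF that, of F1] val[OF that, of F2] val[OF that, of F3] sum4[of h]
        by auto
    qed
    moreover have "double h x" if "mx h x = 2"
      using val[OF \<open>h \<in> perp x\<close>] that w by (simp add: double_def)
    moreover have "mx h x = 0 \<or> mx h x = 1 \<or> mx h x = 2 \<or> mx h x = 3 \<or> mx h x = 4"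
      using calculation(1) by linarith
    ultimately show ?thesis using pos[of h] by auto
  qed
  have "\<exists>h\<in>perp x. mx h x = 4"
  proof (rule ccontr)
    assume "\<not> ?thesis"
    then have "mx h x - 1 = (if double h x then 1 else 0)" if "h \<in> perp x" for h
    proof -
      have "\<not> double h x" if "mx h x = 1"
      proof
        assume "double h x"
        then obtain s where "mul h x s = 2" using double_segments by metis
        then show False using mul_le_mx[of h x s] that by simp
      qed
      then show ?thesis using mx_cases[OF that] that \<open>\<not> (\<exists>h\<in>perp x. mx h x = 4)\<close> by auto
    qed
    then have "(\<Sum>h\<in>perp x. mx h x - 1) = card {h \<in> perp x. double h x}"
      by (simp add: sum.If_cases Int_def)
    moreover have "12 \<le> 4 * (\<Sum>h\<in>perp x. mx h x - 1)"
      using ge12 e_eq by (simp add: sum_distrib_left)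
    ultimately show False using no_light by simp
  qed
  then obtain h where h: "h \<in> perp x" "mx h x = 4" by blast
  then obtain s where "mul h x s = 4" using mx_attained by metis
  then have "lwt h \<le> 8" using segment_bound[OF perp_in_pg[OF h(1)] perp_sym[OF x h(1)], of s] h w by simp
  then show "\<exists>h\<in>perp x. lwt h \<le> 8" using h by blast
qed

text \<open>Consider the four lines through a segment of two points in one double class. Double
  classes contribute an even number to each line, so the bound 5 drops to 4 and the total to 16;
  four double classes would contribute \<open>4 * 2 + 3 * 4 = 20\<close>.\<close>

lemma card_double_le_3:
  assumes h: "h \<in> pg" shows "card {x \<in> perp h. double h x} \<le> 3"
proof (rule ccontr)
  assume "\<not> ?thesis"
  then obtain T where T: "T \<subseteq> {x \<in> perp h. double h x}" "card T = 4"
    using obtain_subset_with_card_n[of 4 "{x \<in> perp h. double h x}"] by auto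
  then have fT: "finite T" using finite_subset[OF T(1)] by simp
  have "T \<noteq> {}" using T(2) by auto
  then obtain x where x: "x \<in> T" by blast
  then have xh: "x \<in> perp h" "double h x" using T by auto
  obtain s where s: "mul h x s = 2" using double_segments[OF xh(2)] by metis
  obtain g where g: "\<And>t. dot (g t) x = s" "\<And>y. y \<in> perp h \<Longrightarrow> y \<noteq> x \<Longrightarrow> bij (\<lambda>t::f4. dot (g t) y)"
    using row[OF h xh(1), of s] by blast
  have le4: "(\<Sum>y\<in>T. mul h y (dot (g t) y)) \<le> 4" for t
  proof -
    have "(\<Sum>y\<in>T. mul h y (dot (g t) y)) \<le> (\<Sum>y\<in>perp h. mul h y (dot (g t) y))"
      using T by (intro sum_mono2) auto
    also have "\<dots> \<le> 5" by (rule cover_sum[OF h])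
    finally have "(\<Sum>y\<in>T. mul h y (dot (g t) y)) \<le> 5" .
    moreover have "even (\<Sum>y\<in>T. mul h y (dot (g t) y))"
    proof (rule dvd_sum)
      fix y assume "y \<in> T"
      then have "double h y" using T by auto
      then have "mul h y (dot (g t) y) = 0 \<or> mul h y (dot (g t) y) = 2" unfolding double_def by blast
      then show "even (mul h y (dot (g t) y))" by auto
    qed
    moreover have "n \<le> 4" if "n \<le> 5" "even n" for n :: nat using that by presburger
    ultimately show ?thesis by blast
  qed
  have "(\<Sum>t::f4\<in>UNIV. \<Sum>y\<in>T. mul h y (dot (g t) y)) \<le> (\<Sum>t::f4\<in>UNIV. 4)"
    by (intro sum_mono le4)
  also have "\<dots> = 16" by simp
  also have "(\<Sum>t::f4\<in>UNIV. \<Sum>y\<in>T. mul h y (dot (g t) y)) =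
      (\<Sum>y\<in>T. \<Sum>t::f4\<in>UNIV. mul h y (dot (g t) y))" by (rule sum.swap)
  also have "\<dots> = (\<Sum>t::f4\<in>UNIV. mul h x (dot (g t) x)) +
      (\<Sum>y\<in>T - {x}. \<Sum>t::f4\<in>UNIV. mul h y (dot (g t) y))"
    by (rule sum.remove[OF fT x])
  also have "(\<Sum>t::f4\<in>UNIV. mul h x (dot (g t) x)) = 8" by (simp add: g(1) s)
  also have "(\<Sum>y\<in>T - {x}. \<Sum>t::f4\<in>UNIV. mul h y (dot (g t) y)) = (\<Sum>y\<in>T - {x}. 4)"
  proof (rule sum.cong[OF refl])
    fix y assume "y \<in> T - {x}"
    then have "y \<in> perp h" "y \<noteq> x" "wt y = 4" using T by (auto simp: double_def)
    then show "(\<Sum>t::f4\<in>UNIV. mul h y (dot (g t) y)) = 4" using g(2) by (simp add: sum_mul_bij)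
  qed
  also have "\<dots> = 12" using T(2) x by simp
  finally show False by simp
qed

text \<open>In the coordinates placing the double segments at 0 and 1, the lines leave room for 1 or
  3 further points where both or only one of the two classes contributes 2. The grid bound then
  gives \<open>4 + 4 + 6\<close>.\<close>

lemma two_doubles_lwt:
  assumes h: "h \<in> pg" and x: "x \<in> perp h" and y: "y \<in> perp h" and "x \<noteq> y"
    and d: "double h x" "double h y" and nz: "\<And>z. z \<in> perp h \<Longrightarrow> wt z \<noteq> 0"
  shows "lwt h \<le> 14"
proof -
  obtain X1 X2 where X: "X1 \<noteq> X2" "mul h x X1 = 2" "mul h x X2 = 2" using double_segments[OF d(1)] .
  obtain Y1 Y2 where Y: "Y1 \<noteq> Y2" "mul h y Y1 = 2" "mul h y Y2 = 2" using double_segments[OF d(2)] .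
  obtain G c p z where Gx: "\<And>s t. dot (G s t) x = X1 + s * (X2 - X1)" and Gy: "\<And>s t. dot (G s t) y = Y1 + t * (Y2 - Y1)"
    and z: "bij_betw z (UNIV - {0}) (perp h - {x, y})" and p: "\<And>l. l \<noteq> 0 \<Longrightarrow> p l \<noteq> 0"
    and Gz: "\<And>s t l. l \<noteq> 0 \<Longrightarrow> dot (G s t) (z l) = c l + (s + l * t) * p l"
    using grid_coordinates[OF h x y \<open>x \<noteq> y\<close> X(1) Y(1)] by metis
  define A where "A l i = mul h (z l) (c l + i * p l)" for l i
  have sumA: "(\<Sum>i\<in>UNIV. A l i) = wt (z l)" if "l \<noteq> 0" for l
    unfolding A_def by (rule sum_mul_bij[OF bij_affine[OF p[OF that]]])
  have nonzero: "UNIV - {0} = {F1, F2, F3}" by (auto simp: UNIV_f4 zero_f4_def)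
  have split: "(\<Sum>w\<in>perp h. f w) = f x + f y + (f (z F1) + f (z F2) + f (z F3))" for f :: "v3 \<Rightarrow> nat"
  proof -
    have "(\<Sum>w\<in>perp h. f w) = f x + (f y + (\<Sum>w\<in>perp h - {x} - {y}. f w))"
      using x y \<open>x \<noteq> y\<close> sum.remove[OF finite_perp x, of f] sum.remove[of "perp h - {x}" y f] by simp
    also have "perp h - {x} - {y} = perp h - {x, y}" by blast
    also have "(\<Sum>w\<in>perp h - {x, y}. f w) = (\<Sum>l\<in>UNIV - {0}. f (z l))"
      by (rule sum.reindex_bij_betw[OF z, symmetric])
    finally show ?thesis by (simp add: nonzero)
  qed
  have cell: "mul h x (X1 + s * (X2 - X1)) + mul h y (Y1 + t * (Y2 - Y1)) +
      (A F1 (s + F1 * t) + A F2 (s + F2 * t) + A F3 (s + F3 * t)) \<le> 5" for s t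
  proof -
    have "F1 \<noteq> 0" "F2 \<noteq> 0" "F3 \<noteq> 0" by (simp_all add: zero_f4_def)
    then show ?thesis using cover_sum[OF h, of "G s t"] by (simp add: split Gx Gy Gz A_def)
  qed
  have sums: "A l F0 + A l F1 + A l F2 + A l F3 = wt (z l)" "1 \<le> wt (z l)" "wt (z l) \<le> 4" if "l \<noteq> 0" for l
  proof -
    show "A l F0 + A l F1 + A l F2 + A l F3 = wt (z l)" using sumA[OF that] by (simp add: UNIV_f4)
    have "z l \<in> perp h" using bij_betwE[OF z] that by simp
    then show "1 \<le> wt (z l)" "wt (z l) \<le> 4" using nz[of "z l"] wt_le_4[of "z l"] perp_subset[of h] by auto
  qed
  have x01: "mul h x (X1 + F0 * (X2 - X1)) = 2" "mul h x (X1 + F1 * (X2 - X1)) = 2"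
    using X(2,3) by (simp_all flip: zero_f4_def one_f4_def)
  have y01: "mul h y (Y1 + F0 * (Y2 - Y1)) = 2" "mul h y (Y1 + F1 * (Y2 - Y1)) = 2"
    using Y(2,3) by (simp_all flip: zero_f4_def one_f4_def)
  \<comment> \<open>These tables turn the indices \<open>s + l * t\<close> into constants, so that
    the cells match the hypotheses of the grid bound.\<close>
  have tab: "F0 + a = a" "F0 * a = F0" "F1 * a = a" "a * F0 = F0" "a + F0 = a" "a + a = F0"
    "F1 + F2 = F3" "F1 + F3 = F2" "F2 + F3 = F1" "F2 + F1 = F3" "F3 + F1 = F2" "F3 + F2 = F1"
    "F2 * F1 = F2" "F3 * F1 = F3" "F2 * F2 = F3" "F2 * F3 = F1" "F3 * F2 = F1" "F3 * F3 = F2" for a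
    by (cases a; simp add: plus_f4_def times_f4_def)+
  have x2: "A F1 (s + F1 * t) + A F2 (s + F2 * t) + A F3 (s + F3 * t) \<le> 3" if "s = F0 \<or> s = F1 \<or> t = F0 \<or> t = F1" for s t
    using cell[of s t] x01 y01 that by auto
  have xy4: "A F1 (s + F1 * t) + A F2 (s + F2 * t) + A F3 (s + F3 * t) \<le> 1"
    if "s = F0 \<or> s = F1" "t = F0 \<or> t = F1" for s t
    using cell[of s t] x01 y01 that by auto
  have "(A F1 F0 + A F1 F1 + A F1 F2 + A F1 F3) + (A F2 F0 + A F2 F1 + A F2 F2 + A F2 F3)
      + (A F3 F0 + A F3 F1 + A F3 F2 + A F3 F3) \<le> 6"
    by (rule two_doubles_grid_bound)
      (use xy4[of F0 F0] xy4[of F1 F0] xy4[of F0 F1] xy4[of F1 F1]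
      x2[of F2 F0] x2[of F3 F0] x2[of F2 F1] x2[of F3 F1] x2[of F0 F2] x2[of F1 F2] x2[of F0 F3] x2[of F1 F3]
        in \<open>simp_all add: tab sums sums(2)[unfolded One_nat_def] zero_f4_def\<close>)
  then have "wt (z F1) + wt (z F2) + wt (z F3) \<le> 6"
    by (simp add: sums zero_f4_def)
  moreover have "wt x = 4" "wt y = 4" using d by (simp_all add: double_def)
  ultimately show ?thesis unfolding lwt_def split by simp
qed

text \<open>Any two of the three points share a segment, and \<open>segment_bound\<close> with two
  points gives \<open>20 + 3 - 8\<close>.\<close>

lemma triple_lwt:
  assumes x: "x \<in> pg" and w: "wt x = 3" shows "\<exists>h\<in>perp x. lwt h \<le> 15"
proof -
  have "\<not> card {P \<in> K. cl P = x} \<le> Suc 0" using w by (simp add: wt_def)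
  then obtain P Q where PQ: "P \<in> K" "Q \<in> K" "cl P = x" "cl Q = x" "P \<noteq> Q"
    using finite_K by (auto simp: card_le_Suc0_iff_eq)
  then obtain h where h: "h \<in> pg" "dot h x = 0" "seg P h = seg Q h"
    using same_seg[of P Q] by auto
  then have hx: "h \<in> perp x" "x \<in> perp h" using x by (simp_all add: perp_def dot_commute[of x])
  have "card {P, Q} \<le> mul h x (seg P h)"
    unfolding mul_def using finite_K PQ h by (intro card_mono) auto
  then have "2 \<le> mul h x (seg P h)" using PQ by simp
  then have "lwt h \<le> 15" using segment_bound[OF h(1) hx(2), of "seg P h"] w by simp
  then show ?thesis using hx by blast
qed

text \<open>On each line \<open>d\<close> and \<open>wt\<close> add up to 20, so the thresholds 4,
  6, 12 and 5 of \<open>deficiency\<close> are the complements of the weights 16, 14, 8 and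
  15.\<close>

lemma contradiction: False
proof -
  define d where "d x = 4 - wt x" for x
  define D where "D h x \<longleftrightarrow> h \<in> pg \<and> x \<in> perp h \<and> double h x" for h x
  have dw: "d x + wt x = 4" if "x \<in> pg" for x using wt_le_4[OF that] by (simp add: d_def)
  have dl: "(\<Sum>x\<in>perp h. d x) + lwt h = 20" if "h \<in> pg" for h
  proof -
    have "(\<Sum>x\<in>perp h. d x) + lwt h = (\<Sum>x\<in>perp h. d x + wt x)" by (simp add: lwt_def sum.distrib)
    also have "\<dots> = (\<Sum>x\<in>perp h. 4)" by (intro sum.cong refl dw perp_in_pg)
    finally show ?thesis using card_perp[OF that] by simp
  qed
  have "deficiency pg perp d D"
  proof (unfold_locales)
    show "d x \<le> 4" for x by (simp add: d_def)
    have "(\<Sum>x\<in>pg. d x) + (\<Sum>x\<in>pg. wt x) = (\<Sum>x\<in>pg. 4)"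
      unfolding sum.distrib[symmetric] by (intro sum.cong refl dw)
    then show "(\<Sum>x\<in>pg. d x) = 15" by (simp add: sum_wt card_pg)
    show "h \<in> pg \<and> x \<in> perp h \<and> d x = 0" if "D h x" for h x
      using that by (simp add: D_def d_def double_def)
    show "card {x \<in> pg. D h x} \<le> 3" if "h \<in> pg" for h
    proof -
      have "{x \<in> pg. D h x} = {x \<in> perp h. double h x}"
        using that perp_in_pg unfolding D_def by blast
      then show ?thesis using card_double_le_3[OF that] by simp
    qed
    show "4 \<le> (\<Sum>x\<in>perp h. d x)" if "D h x" for h x
      using that double_lwt[of h x] dl[of h] by (simp add: D_def)
    show "6 \<le> (\<Sum>x\<in>perp h. d x)" if "D h x" "D h y" "x \<noteq> y" "\<forall>z\<in>perp h. d z \<noteq> 4" for h x y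
    proof -
      have "wt z \<noteq> 0" if "z \<in> perp h" for z using \<open>\<forall>z\<in>perp h. d z \<noteq> 4\<close> that by (auto simp: d_def)
      then have "lwt h \<le> 14" using two_doubles_lwt[of h x y] that by (simp add: D_def)
      then show ?thesis using dl[of h] that by (simp add: D_def)
    qed
    show "(\<exists>h\<in>perp x. 12 \<le> (\<Sum>x\<in>perp h. d x)) \<or> 3 \<le> card {h \<in> pg. D h x}" if x: "x \<in> pg" "d x = 0" for x
    proof -
      have "wt x = 4" using dw[OF x(1)] x(2) by simp
      moreover have "{h \<in> perp x. double h x} = {h \<in> pg. D h x}"
        using x(1) perp_in_pg perp_sym unfolding D_def by blast
      moreover have "12 \<le> (\<Sum>x\<in>perp h. d x)" if "h \<in> perp x" "lwt h \<le> 8" for h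
        using dl[OF perp_in_pg[OF that(1)]] that(2) by simp
      ultimately show ?thesis using wt_4_cases[OF x(1)] by metis
    qed
    show "\<exists>h\<in>perp x. 5 \<le> (\<Sum>x\<in>perp h. d x)" if x: "x \<in> pg" "d x = 1" for x
    proof -
      have "wt x = 3" using dw[OF x(1)] x(2) by simp
      then obtain h where h: "h \<in> perp x" "lwt h \<le> 15" using triple_lwt[OF x(1)] by blast
      then show ?thesis using dl[OF perp_in_pg[OF h(1)]] by (intro bexI[of _ h]) simp_all
    qed
  qed
  then show False by (rule deficiency.contradiction)
qed

end

section \<open>Projective Hjelmslev planes over chain rings with residue field of order four\<close>

lemma f4_add_self [simp]: "(a::f4) + a = 0"
  by (cases a) (simp_all add: f4_defs)

text \<open>\<open>nil b\<close> is \<open>b\<theta>\<close> for a generator \<open>\<theta>\<close> of the radical, and \<open>tw\<close> is the automorphism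
  with \<open>\<theta> r = tw r \<theta>\<close>.\<close>

locale f4_chain_ring = ring R for R (structure) +
  fixes red :: "'a \<Rightarrow> f4" and nil :: "f4 \<Rightarrow> 'a" and tw :: "f4 \<Rightarrow> f4"
  assumes finite_R: "finite (carrier R)"
    and red_add: "\<lbrakk>x \<in> carrier R; y \<in> carrier R\<rbrakk> \<Longrightarrow> red (x \<oplus> y) = red x + red y"
    and red_mult: "\<lbrakk>x \<in> carrier R; y \<in> carrier R\<rbrakk> \<Longrightarrow> red (x \<otimes> y) = red x * red y"
    and red_one: "red \<one> = 1"
    and red_surj: "\<exists>r\<in>carrier R. red r = a"
    and nil_closed [simp]: "nil b \<in> carrier R"
    and red_nil: "red (nil b) = 0"
    and red_eq_0: "\<lbrakk>x \<in> carrier R; red x = 0\<rbrakk> \<Longrightarrow> \<exists>b. x = nil b"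
    and nil_add: "nil b \<oplus> nil c = nil (b + c)"
    and nil_eq_zero: "nil b = \<zero> \<longleftrightarrow> b = 0"
    and mult_nil: "x \<in> carrier R \<Longrightarrow> x \<otimes> nil b = nil (red x * b)"
    and nil_mult: "x \<in> carrier R \<Longrightarrow> nil b \<otimes> x = nil (b * tw (red x))"
    and tw_add: "tw (a + b) = tw a + tw b" and tw_mult: "tw (a * b) = tw a * tw b"
    and tw_tw: "tw (tw a) = a"
begin

lemma nil_0: "nil 0 = \<zero>" by (simp add: nil_eq_zero)

lemma diff_nil:
  assumes "x \<in> carrier R" "y \<in> carrier R" "red x = red y"
  shows "\<exists>b. x = y \<oplus> nil b"
proof -
  have eq: "x = y \<oplus> (x \<ominus> y)" using assms by (simp add: minus_eq a_lcomm[of y x] r_neg)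
  then have "red x = red y + red (x \<ominus> y)" using red_add[of y "x \<ominus> y"] assms by simp
  then have "red (x \<ominus> y) = 0" using assms(3) by simp
  then obtain b where "x \<ominus> y = nil b" using red_eq_0[of "x \<ominus> y"] assms by auto
  then show ?thesis using eq by metis
qed

text \<open>A lift \<open>s\<close> of the inverse residue gives
  \<open>x \<otimes> s = \<one> \<oplus> nil b\<close>. This element is its own inverse, because
  \<open>nil b\<close> squares to zero and doubles to zero.\<close>

lemma right_inverse:
  assumes x: "x \<in> carrier R" "red x \<noteq> 0"
  obtains y where "y \<in> carrier R" "red y \<noteq> 0" "x \<otimes> y = \<one>"
proof -
  obtain s where s: "s \<in> carrier R" "red s = inverse (red x)" using red_surj by blast
  have "red (x \<otimes> s) = red \<one>" using x s by (simp add: red_mult red_one)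
  then obtain b where b: "x \<otimes> s = \<one> \<oplus> nil b" using diff_nil[of "x \<otimes> s" \<one>] x s by auto
  have "(\<one> \<oplus> nil b) \<otimes> (\<one> \<oplus> nil b) = \<one> \<oplus> (nil b \<oplus> nil b) \<oplus> nil b \<otimes> nil b"
    by (simp add: l_distr r_distr a_assoc)
  also have "\<dots> = \<one>" by (simp add: nil_add mult_nil red_nil nil_0)
  finally have "x \<otimes> (s \<otimes> (\<one> \<oplus> nil b)) = \<one>" using b x s by (simp add: m_assoc[symmetric])
  moreover have "red (s \<otimes> (\<one> \<oplus> nil b)) \<noteq> 0"
    using x s by (simp add: red_mult red_add red_one red_nil)
  ultimately show thesis using that[of "s \<otimes> (\<one> \<oplus> nil b)"] s by simp
qed

text \<open>The right inverse \<open>y\<close> has a right inverse in turn, which must equal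
  \<open>x\<close>.\<close>

lemma two_sided_inverse:
  assumes x: "x \<in> carrier R" "red x \<noteq> 0"
  obtains y where "y \<in> carrier R" "x \<otimes> y = \<one>" "y \<otimes> x = \<one>"
proof -
  obtain y where y: "y \<in> carrier R" "red y \<noteq> 0" "x \<otimes> y = \<one>" using right_inverse[OF x] .
  obtain z where z: "z \<in> carrier R" "y \<otimes> z = \<one>" using right_inverse[OF y(1,2)] by metis
  have "x = x \<otimes> (y \<otimes> z)" using x z by simp
  also have "\<dots> = x \<otimes> y \<otimes> z" by (rule m_assoc[OF x(1) y(1) z(1), symmetric])
  also have "\<dots> = z" using y z by simp
  finally show thesis using that y z by simp
qed

text \<open>Coefficients stand on the left, so the form is linear for the right module and its
  kernel is a right submodule.\<close>

fun dotR :: "'a vec3 \<Rightarrow> 'a vec3 \<Rightarrow> 'a" where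
  "dotR (a,b,c) (x,y,z) = a \<otimes> x \<oplus> (b \<otimes> y \<oplus> c \<otimes> z)"

fun redv :: "'a vec3 \<Rightarrow> v3" where "redv (x,y,z) = (red x, red y, red z)"

lemma vcarrier_iff [simp]: "(x,y,z) \<in> vcarrier R \<longleftrightarrow> x \<in> carrier R \<and> y \<in> carrier R \<and> z \<in> carrier R"
  by (simp add: vcarrier_def)

lemma vsmul_closed: "v \<in> vcarrier R \<Longrightarrow> r \<in> carrier R \<Longrightarrow> vsmul R v r \<in> vcarrier R"
  by (cases v) (simp add: vsmul_def)

lemma dotR_closed: "h \<in> vcarrier R \<Longrightarrow> v \<in> vcarrier R \<Longrightarrow> dotR h v \<in> carrier R"
  by (cases h; cases v) simp

lemma dotR_vadd: "\<lbrakk>h \<in> vcarrier R; u \<in> vcarrier R; v \<in> vcarrier R\<rbrakk> \<Longrightarrow> dotR h (vadd R u v) = dotR h u \<oplus> dotR h v"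
  by (cases h; cases u; cases v) (simp add: vadd_def r_distr a_ac)

lemma dotR_vsmul: "\<lbrakk>h \<in> vcarrier R; v \<in> vcarrier R; r \<in> carrier R\<rbrakk> \<Longrightarrow> dotR h (vsmul R v r) = dotR h v \<otimes> r"
  by (cases h; cases v) (simp add: vsmul_def l_distr m_assoc)

lemma red_dotR: "\<lbrakk>h \<in> vcarrier R; v \<in> vcarrier R\<rbrakk> \<Longrightarrow> red (dotR h v) = dot (redv h) (redv v)"
  by (cases h; cases v) (simp add: red_add red_mult add.assoc)

lemma free_rank_2I:
  assumes e: "e \<in> vcarrier R" "f \<in> vcarrier R"
    and bij: "bij_betw (\<lambda>(p, q). vadd R (vsmul R e p) (vsmul R f q)) (carrier R \<times> carrier R) U"
  shows "free_rank R 2 U"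
proof -
  let ?v = "\<lambda>i::nat. if i = 0 then e else f"
  have "bij_betw (\<lambda>c. (c 0, c (Suc 0))) ({0..<2::nat} \<rightarrow>\<^sub>E carrier R) (carrier R \<times> carrier R)"
    by (rule bij_betw_byWitness[where f' = "\<lambda>(p,q). \<lambda>i\<in>{0..<2}. if i = 0 then p else q"])
      (auto simp: PiE_iff extensional_def fun_eq_iff less_Suc_eq numeral_2_eq_2)
  from bij_betw_trans[OF this bij]
  have "bij_betw (\<lambda>c. vadd R (vsmul R e (c 0)) (vsmul R f (c (Suc 0)))) ({0..<2::nat} \<rightarrow>\<^sub>E carrier R) U"
    by (simp add: comp_def)
  moreover have "lincomb R ?v c 2 = vadd R (vsmul R e (c 0)) (vsmul R f (c (Suc 0)))"
    if "c \<in> {0..<2::nat} \<rightarrow>\<^sub>E carrier R" for c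
  proof -
    have "c 0 \<in> carrier R" "c (Suc 0) \<in> carrier R" using that by (auto simp: PiE_iff)
    then show ?thesis using e by (cases e; cases f) (simp add: numeral_2_eq_2 vadd_def vsmul_def vzero_def)
  qed
  ultimately have "bij_betw (\<lambda>c. lincomb R ?v c 2) ({0..<2} \<rightarrow>\<^sub>E carrier R) U"
    by (simp cong: bij_betw_cong)
  then show ?thesis unfolding free_rank_def using e by (intro exI[of _ ?v]) simp
qed

lemma solve_linear:
  assumes "a \<in> carrier R" "u \<in> carrier R" "a \<otimes> u = \<one>" "u \<otimes> a = \<one>" "x \<in> carrier R" "s \<in> carrier R"
  shows "a \<otimes> x \<oplus> s = \<zero> \<longleftrightarrow> x = \<ominus> (u \<otimes> s)"
proof
  assume "a \<otimes> x \<oplus> s = \<zero>"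
  then have "u \<otimes> (a \<otimes> x \<oplus> s) = \<zero>" using assms by simp
  then have "x \<oplus> u \<otimes> s = \<zero>" using assms by (simp add: r_distr m_assoc[symmetric])
  then show "x = \<ominus> (u \<otimes> s)" using assms by (simp add: minus_equality)
next
  assume "x = \<ominus> (u \<otimes> s)"
  then show "a \<otimes> x \<oplus> s = \<zero>" using assms by (simp add: r_minus m_assoc[symmetric] l_neg)
qed

lemma basis_coordinate:
  assumes "u \<in> carrier R" "b \<in> carrier R" "c \<in> carrier R" "p \<in> carrier R" "q \<in> carrier R"
  shows "\<ominus> (u \<otimes> b) \<otimes> p \<oplus> \<ominus> (u \<otimes> c) \<otimes> q = \<ominus> (u \<otimes> (b \<otimes> p \<oplus> c \<otimes> q))"
  using assms by (simp add: r_distr l_minus m_assoc minus_add)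

text \<open>A coefficient with nonzero residue is a unit. Solving for its coordinate leaves the
  other two free, which exhibits a basis.\<close>

lemma hline_kernel:
  assumes h: "h \<in> vcarrier R" "redv h \<noteq> (0,0,0)"
  shows "{v \<in> vcarrier R. dotR h v = \<zero>} \<in> hlines R" (is "?L \<in> _")
proof -
  obtain a b c where abc: "h = (a,b,c)" by (cases h)
  then have car: "a \<in> carrier R" "b \<in> carrier R" "c \<in> carrier R" using h(1) by auto
  have "vzero R \<in> ?L" using car abc by (simp add: vzero_def)
  then have "right_submodule R ?L"
    unfolding right_submodule_def using h(1)
    by (auto simp: dotR_vadd dotR_vsmul vsmul_closed) (auto simp: vadd_def vcarrier_def)
  moreover have "free_rank R 2 ?L"
  proof -
    consider "red a \<noteq> 0" | "red b \<noteq> 0" | "red c \<noteq> 0" using h(2) abc by auto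
    then show ?thesis
    proof cases
      case 1
      obtain u where u: "u \<in> carrier R" "a \<otimes> u = \<one>" "u \<otimes> a = \<one>" using two_sided_inverse[OF car(1) 1] .
      have L: "?L = {(x,y,z). (x,y,z) \<in> vcarrier R \<and> x = \<ominus> (u \<otimes> (b \<otimes> y \<oplus> c \<otimes> z))}"
        using car u by (auto simp: abc solve_linear[OF car(1) u])
      show ?thesis
      proof (rule free_rank_2I[of "(\<ominus> (u \<otimes> b), \<one>, \<zero>)" "(\<ominus> (u \<otimes> c), \<zero>, \<one>)"])
        show "bij_betw (\<lambda>(p, q). vadd R (vsmul R (\<ominus> (u \<otimes> b), \<one>, \<zero>) p) (vsmul R (\<ominus> (u \<otimes> c), \<zero>, \<one>) q))
          (carrier R \<times> carrier R) ?L"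
          unfolding L by (rule bij_betw_byWitness[where f' = "\<lambda>(x,y,z). (y,z)"])
            (use car u in \<open>auto simp: vadd_def vsmul_def basis_coordinate\<close>)
      qed (use car u in auto)
    next
      case 2
      obtain u where u: "u \<in> carrier R" "b \<otimes> u = \<one>" "u \<otimes> b = \<one>" using two_sided_inverse[OF car(2) 2] .
      have "a \<otimes> x \<oplus> (b \<otimes> y \<oplus> c \<otimes> z) = b \<otimes> y \<oplus> (a \<otimes> x \<oplus> c \<otimes> z)"
        if "x \<in> carrier R" "y \<in> carrier R" "z \<in> carrier R" for x y z
        using car that by (simp add: a_lcomm)
      then have L: "?L = {(x,y,z). (x,y,z) \<in> vcarrier R \<and> y = \<ominus> (u \<otimes> (a \<otimes> x \<oplus> c \<otimes> z))}"
        using car u by (auto simp: abc solve_linear[OF car(2) u])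
      show ?thesis
      proof (rule free_rank_2I[of "(\<one>, \<ominus> (u \<otimes> a), \<zero>)" "(\<zero>, \<ominus> (u \<otimes> c), \<one>)"])
        show "bij_betw (\<lambda>(p, q). vadd R (vsmul R (\<one>, \<ominus> (u \<otimes> a), \<zero>) p) (vsmul R (\<zero>, \<ominus> (u \<otimes> c), \<one>) q))
          (carrier R \<times> carrier R) ?L"
          unfolding L by (rule bij_betw_byWitness[where f' = "\<lambda>(x,y,z). (x,z)"])
            (use car u in \<open>auto simp: vadd_def vsmul_def basis_coordinate\<close>)
      qed (use car u in auto)
    next
      case 3
      obtain u where u: "u \<in> carrier R" "c \<otimes> u = \<one>" "u \<otimes> c = \<one>" using two_sided_inverse[OF car(3) 3] .
      have "a \<otimes> x \<oplus> (b \<otimes> y \<oplus> c \<otimes> z) = c \<otimes> z \<oplus> (a \<otimes> x \<oplus> b \<otimes> y)"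
        if "x \<in> carrier R" "y \<in> carrier R" "z \<in> carrier R" for x y z
        using car that by (simp add: a_ac)
      then have L: "?L = {(x,y,z). (x,y,z) \<in> vcarrier R \<and> z = \<ominus> (u \<otimes> (a \<otimes> x \<oplus> b \<otimes> y))}"
        using car u by (auto simp: abc solve_linear[OF car(3) u])
      show ?thesis
      proof (rule free_rank_2I[of "(\<one>, \<zero>, \<ominus> (u \<otimes> a))" "(\<zero>, \<one>, \<ominus> (u \<otimes> b))"])
        show "bij_betw (\<lambda>(p, q). vadd R (vsmul R (\<one>, \<zero>, \<ominus> (u \<otimes> a)) p) (vsmul R (\<zero>, \<one>, \<ominus> (u \<otimes> b)) q))
          (carrier R \<times> carrier R) ?L"
          unfolding L by (rule bij_betw_byWitness[where f' = "\<lambda>(x,y,z). (x,y)"])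
            (use car u in \<open>auto simp: vadd_def vsmul_def basis_coordinate\<close>)
      qed (use car u in auto)
    qed
  qed
  ultimately show ?thesis by (simp add: hlines_def)
qed

text \<open>A generator with zero residue would be annihilated by \<open>nil 1\<close>, against
  freeness. A unit multiple then moves the residue to the chosen representative in
  \<open>pg\<close>.\<close>

lemma hpoint_generator:
  assumes "P \<in> hpoints R"
  obtains v where "v \<in> vcarrier R" "redv v \<in> pg" "P = vsmul R v ` carrier R"
proof -
  obtain e where e: "\<And>i. i < 1 \<Longrightarrow> e i \<in> vcarrier R"
    and bij: "bij_betw (\<lambda>c. lincomb R e c 1) ({0..<1::nat} \<rightarrow>\<^sub>E carrier R) P"
    using assms by (auto simp: hpoints_def free_rank_def)
  obtain x y z where xyz: "e 0 = (x,y,z)" by (cases "e 0")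
  then have car: "x \<in> carrier R" "y \<in> carrier R" "z \<in> carrier R" using e[of 0] by auto
  have lin: "lincomb R e c 1 = vsmul R (x,y,z) (c 0)" if "c 0 \<in> carrier R" for c
    using that car xyz by (simp add: vadd_def vsmul_def vzero_def)
  let ?f = "\<lambda>r. \<lambda>i\<in>{0..<1::nat}. r"
  have fE: "?f r \<in> {0..<1::nat} \<rightarrow>\<^sub>E carrier R" if "r \<in> carrier R" for r using that by auto
  have P: "P = vsmul R (x,y,z) ` carrier R"
  proof -
    have "P = (\<lambda>c. lincomb R e c 1) ` ({0..<1::nat} \<rightarrow>\<^sub>E carrier R)" using bij by (simp add: bij_betw_def)
    also have "\<dots> = (\<lambda>c. vsmul R (x,y,z) (c 0)) ` ({0..<1::nat} \<rightarrow>\<^sub>E carrier R)"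
      by (intro image_cong refl lin) (auto simp: PiE_iff)
    also have "\<dots> = vsmul R (x,y,z) ` carrier R"
    proof (intro equalityI subsetI)
      fix v assume "v \<in> vsmul R (x,y,z) ` carrier R"
      then obtain r where "r \<in> carrier R" "v = vsmul R (x,y,z) r" by blast
      then show "v \<in> (\<lambda>c. vsmul R (x,y,z) (c 0)) ` ({0..<1::nat} \<rightarrow>\<^sub>E carrier R)"
        using fE[of r] by (intro image_eqI[of _ _ "?f r"]) auto
    qed (auto simp: PiE_iff)
    finally show ?thesis .
  qed
  have "(red x, red y, red z) \<noteq> (0,0,0)"
  proof
    assume "(red x, red y, red z) = (0,0,0)"
    then have "vsmul R (x,y,z) (nil 1) = vsmul R (x,y,z) \<zero>"
      using car by (simp add: vsmul_def mult_nil nil_0)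
    then have "lincomb R e (?f (nil 1)) 1 = lincomb R e (?f \<zero>) 1" by (simp add: lin del: lincomb.simps One_nat_def)
    then have "?f (nil 1) = ?f \<zero>"
      using bij_betw_imp_inj_on[OF bij] fE[of "nil 1"] fE[of \<zero>] by (meson inj_onD nil_closed zero_closed)
    then have "?f (nil 1) 0 = ?f \<zero> 0" by metis
    then show False by (simp add: nil_eq_zero)
  qed
  then obtain k where k: "k \<noteq> 0" "(red x * k, red y * k, red z * k) \<in> pg" using scale_to_pg by metis
  obtain r where r: "r \<in> carrier R" "red r = k" using red_surj by blast
  then obtain u where u: "u \<in> carrier R" "r \<otimes> u = \<one>" using two_sided_inverse[of r] k by metis
  show thesis
  proof (rule that[of "vsmul R (x,y,z) r"])
    show "vsmul R (x,y,z) r \<in> vcarrier R" using car r by (simp add: vsmul_def)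
    show "redv (vsmul R (x,y,z) r) \<in> pg" using car r k by (simp add: vsmul_def red_mult)
    have "vsmul R (vsmul R (x,y,z) r) s = vsmul R (x,y,z) (r \<otimes> s)" if "s \<in> carrier R" for s
      using car r that by (simp add: vsmul_def m_assoc)
    moreover have "(\<otimes>) r ` carrier R = carrier R"
    proof (intro equalityI subsetI)
      fix s assume "s \<in> carrier R"
      then show "s \<in> (\<otimes>) r ` carrier R"
        using r u by (intro image_eqI[of _ _ "u \<otimes> s"]) (simp_all add: m_assoc[symmetric])
    qed (use r in auto)
    ultimately show "P = vsmul R (vsmul R (x,y,z) r) ` carrier R"
      unfolding P by (metis (no_types, lifting) image_cong image_image)
  qed
qed

lemma arc_residual:
  assumes K: "proj_arc R 69 5 K" shows False
proof -
  have Kp: "K \<subseteq> hpoints R" and cK: "card K = 69"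
    and lines: "\<And>L. L \<in> hlines R \<Longrightarrow> card {P \<in> K. P \<subseteq> L} \<le> 5" using K by (auto simp: proj_arc_def)
  have finK: "finite K" using cK by (metis card.infinite zero_neq_numeral)
  have "\<exists>v. v \<in> vcarrier R \<and> redv v \<in> pg \<and> P = vsmul R v ` carrier R" if "P \<in> K" for P
    using hpoint_generator[of P] Kp that by blast
  then obtain gen where gen: "\<And>P. P \<in> K \<Longrightarrow> gen P \<in> vcarrier R" "\<And>P. P \<in> K \<Longrightarrow> redv (gen P) \<in> pg"
    "\<And>P. P \<in> K \<Longrightarrow> P = vsmul R (gen P) ` carrier R" by metis
  obtain lft where lft: "\<And>a. lft a \<in> carrier R" "\<And>a. red (lft a) = a" using red_surj by metis
  define lftv where "lftv = (\<lambda>(a,b,c). (lft a, lft b, lft c))"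
  have lftv: "lftv h \<in> vcarrier R" "redv (lftv h) = h" for h by (cases h; simp add: lftv_def lft)+
  \<comment> \<open>The twist is built into the label, so that incidence reads
    \<open>dot g (cl P) = seg P h\<close> in all three rings.\<close>
  define seg where "seg P h = tw (SOME s. dotR (lftv h) (gen P) = nil s)" for P h
  have seg: "dotR (lftv h) (gen P) = nil (tw (seg P h))" if "P \<in> K" "dot h (redv (gen P)) = 0" for P h
  proof -
    have "red (dotR (lftv h) (gen P)) = 0" using that gen lftv by (simp add: red_dotR)
    then have "\<exists>s. dotR (lftv h) (gen P) = nil s" using that gen lftv by (intro red_eq_0 dotR_closed)
    then show ?thesis unfolding seg_def tw_tw by (rule someI_ex)
  qed
  have "residual_arc K (\<lambda>P. redv (gen P)) seg"
  proof
    show "finite K" by (rule finK)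
    show "card K = 69" by (rule cK)
    show "redv (gen P) \<in> pg" if "P \<in> K" for P by (rule gen(2)[OF that])
    show "card {P \<in> K. dot h (redv (gen P)) = 0 \<and> dot g (redv (gen P)) = seg P h} \<le> 5" if h: "h \<in> pg" for h g
    proof -
      obtain h1 h2 h3 where h123: "h = (h1,h2,h3)" by (cases h)
      obtain g1 g2 g3 where g123: "g = (g1,g2,g3)" by (cases g)
      \<comment> \<open>A lift of \<open>h\<close> perturbed in the radical by \<open>g\<close>.
        Moving \<open>nil (tw g1)\<close> past a coordinate twists the coordinate too, so the
        perturbation adds \<open>tw\<close> of \<open>dot g\<close>. It cancels an equal segment
        label because \<open>nil\<close> takes values of additive order at most 2.\<close>
      define H where "H = (lft h1 \<oplus> nil (tw g1), lft h2 \<oplus> nil (tw g2), lft h3 \<oplus> nil (tw g3))"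
      have H: "H \<in> vcarrier R" "redv H = h" by (simp_all add: H_def lft red_add red_nil h123)
      have "redv H \<noteq> (0,0,0)" using H h zero_notin_pg by auto
      then have L: "{v \<in> vcarrier R. dotR H v = \<zero>} \<in> hlines R" by (rule hline_kernel[OF H(1)])
      have dotH: "dotR H v = dotR (lftv h) v \<oplus> nil (tw (dot g (redv v)))" if "v \<in> vcarrier R" for v
      proof -
        obtain x y z where v: "v = (x,y,z)" by (cases v)
        then have car: "x \<in> carrier R" "y \<in> carrier R" "z \<in> carrier R" using that by auto
        have nils: "nil (tw (dot g (redv v))) = nil (tw g1 * tw (red x)) \<oplus> (nil (tw g2 * tw (red y)) \<oplus> nil (tw g3 * tw (red z)))"
          by (simp add: v g123 tw_add tw_mult nil_add add.assoc)
        show ?thesis unfolding nils using car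
          by (simp add: v H_def h123 lftv_def lft l_distr nil_mult a_ac)
      qed
      have "P \<subseteq> {v \<in> vcarrier R. dotR H v = \<zero>}"
        if P: "P \<in> K" "dot h (redv (gen P)) = 0" "dot g (redv (gen P)) = seg P h" for P
      proof -
        have "dotR H (gen P) = nil (tw (seg P h)) \<oplus> nil (tw (seg P h))"
          using dotH[OF gen(1)[OF P(1)]] seg[OF P(1,2)] P(3) by simp
        then have "dotR H (gen P) = \<zero>" by (simp add: nil_add nil_0)
        then have "vsmul R (gen P) r \<in> {v \<in> vcarrier R. dotR H v = \<zero>}" if "r \<in> carrier R" for r
          using that gen(1)[OF P(1)] H by (simp add: vsmul_closed dotR_vsmul)
        then have "vsmul R (gen P) ` carrier R \<subseteq> {v \<in> vcarrier R. dotR H v = \<zero>}" by blast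
        then show ?thesis by (rule ord_eq_le_trans[OF gen(3)[OF P(1)]])
      qed
      then have "card {P \<in> K. dot h (redv (gen P)) = 0 \<and> dot g (redv (gen P)) = seg P h} \<le>
          card {P \<in> K. P \<subseteq> {v \<in> vcarrier R. dotR H v = \<zero>}}"
        using finK by (intro card_mono) auto
      then show ?thesis using lines[OF L] by simp
    qed
    show "\<exists>h\<in>pg. dot h (redv (gen P)) = 0 \<and> seg P h = seg Q h"
      if PQ: "P \<in> K" "Q \<in> K" "redv (gen P) = redv (gen Q)" for P Q
    proof -
      obtain x y z where P: "gen P = (x,y,z)" by (cases "gen P")
      obtain x' y' z' where Q: "gen Q = (x',y',z')" by (cases "gen Q")
      have car: "x \<in> carrier R" "y \<in> carrier R" "z \<in> carrier R" "x' \<in> carrier R" "y' \<in> carrier R" "z' \<in> carrier R"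
        using gen(1)[OF PQ(1)] gen(1)[OF PQ(2)] P Q by auto
      have "red x = red x'" "red y = red y'" "red z = red z'" using PQ(3) P Q by auto
      then obtain b1 b2 b3 where b: "x = x' \<oplus> nil b1" "y = y' \<oplus> nil b2" "z = z' \<oplus> nil b3"
        using diff_nil car by metis
      \<comment> \<open>The generators differ by the radical vector \<open>(b1,b2,b3)\<close>; an
        \<open>h\<close> orthogonal to it does not see the difference.\<close>
      obtain h where h: "h \<in> pg" "dot h (redv (gen P)) = 0" "dot h (b1,b2,b3) = 0"
        using common_perp[OF gen(2)[OF PQ(1)]] by metis
      obtain h1 h2 h3 where h123: "h = (h1,h2,h3)" by (cases h)
      have "nil (dot h (b1,b2,b3)) = nil (h1*b1) \<oplus> (nil (h2*b2) \<oplus> nil (h3*b3))"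
        by (simp add: h123 nil_add add.assoc)
      then have "nil (h1*b1) \<oplus> (nil (h2*b2) \<oplus> nil (h3*b3)) = \<zero>" using h(3) nil_0 by simp
      moreover have "dotR (lftv h) (gen P) =
          dotR (lftv h) (gen Q) \<oplus> (nil (h1*b1) \<oplus> (nil (h2*b2) \<oplus> nil (h3*b3)))"
        unfolding P Q b h123 using car(4-6) by (simp add: lftv_def lft r_distr mult_nil a_ac)
      ultimately have "dotR (lftv h) (gen P) = dotR (lftv h) (gen Q)"
        using gen(1)[OF PQ(2)] lftv by (simp add: dotR_closed)
      then show ?thesis using h by (intro bexI[of _ h]) (simp_all add: seg_def)
    qed
  qed
  then show False by (rule residual_arc.contradiction)
qed

lemma max_arc_le_68: "max_arc R 5 \<le> 68"
proof -
  have "hpoints R \<subseteq> Pow (vcarrier R)" by (auto simp: hpoints_def right_submodule_def)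
  moreover have "finite (vcarrier R)" using finite_R by (simp add: vcarrier_def)
  ultimately have fin: "finite (hpoints R)" by (meson finite_Pow_iff finite_subset)
  have "k \<le> 68" if "proj_arc R k 5 K" for k K
  proof (rule ccontr)
    assume "\<not> k \<le> 68"
    then have "69 \<le> card K" using that by (simp add: proj_arc_def)
    then obtain K' where K': "K' \<subseteq> K" "card K' = 69" by (metis obtain_subset_with_card_n)
    have "card {P \<in> K'. P \<subseteq> L} \<le> 5" if "L \<in> hlines R" for L
    proof -
      have "card {P \<in> K'. P \<subseteq> L} \<le> card {P \<in> K. P \<subseteq> L}"
        using K'(1) \<open>proj_arc R k 5 K\<close> fin by (intro card_mono) (auto simp: proj_arc_def intro: finite_subset)
      also have "\<dots> \<le> 5" using \<open>proj_arc R k 5 K\<close> that by (simp add: proj_arc_def)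
      finally show ?thesis .
    qed
    then have "proj_arc R 69 5 K'" using K' that by (auto simp: proj_arc_def)
    then show False by (rule arc_residual)
  qed
  then have sub: "{k. \<exists>K. proj_arc R k 5 K} \<subseteq> {..68}" by blast
  \<comment> \<open>A witness that the set is nonempty, so that its \<open>Max\<close> is one of its
    members.\<close>
  have "proj_arc R 0 5 {}" by (simp add: proj_arc_def)
  then have "{k. \<exists>K. proj_arc R k 5 K} \<noteq> {}" by blast
  then have "max_arc R 5 \<in> {k. \<exists>K. proj_arc R k 5 K}"
    unfolding max_arc_def by (intro Max_in finite_subset[OF sub]) simp_all
  then show ?thesis using sub by blast
qed
end

section \<open>The three chain rings\<close>

fun enc :: "f4 \<Rightarrow> nat" where "enc F0 = 0" | "enc F1 = 1" | "enc F2 = 2" | "enc F3 = 3"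

definition dec :: "nat \<Rightarrow> f4" where
  "dec n = (if n = 0 then F0 else if n = 1 then F1 else if n = 2 then F2 else F3)"

lemma dec_enc [simp]: "dec (enc a) = a"
  by (cases a) (simp_all add: dec_def)

lemma enc_less [simp]: "enc a < 4"
  by (cases a) simp_all

lemma enc_inject [simp]: "enc a = enc b \<longleftrightarrow> a = b"
  by (metis dec_enc)

lemma enc_zero [simp]: "enc 0 = 0" and enc_one: "enc 1 = 1" by (simp_all add: f4_defs)

lemma range_enc: "n < 4 \<Longrightarrow> \<exists>a. n = enc a"
  unfolding ex_f4 by auto

lemma f4add_enc: "f4add (enc a) (enc b) = enc (a + b)"
  by (cases a; cases b; simp add: f4add_def f4_defs)

lemma f4mul_enc: "f4mul (enc a) (enc b) = enc (a * b)"
  by (cases a; cases b; simp add: f4mul_def f4log_def f4exp_def f4_defs)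

text \<open>Common form of \<open>S4\<close> and \<open>T4\<close>; \<open>fr\<close> is the map by
  which a coefficient changes when \<open>X\<close> moves past it.\<close>

definition skew :: "(nat \<Rightarrow> nat) \<Rightarrow> (nat \<times> nat) ring" where
  "skew fr = \<lparr> carrier = {0..<4} \<times> {0..<4},
          mult = (\<lambda>(a,b) (c,d). (f4mul a c, f4add (f4mul a d) (f4mul b (fr c)))),
          one = (1, 0), zero = (0, 0),
          add = (\<lambda>(a,b) (c,d). (f4add a c, f4add b d)) \<rparr>"

lemma skew_chain_ring:
  assumes fr: "\<And>a. fr (enc a) = enc (tw a)"
    and tw: "\<And>a b. tw (a + b) = tw a + tw b" "\<And>a b. tw (a * b) = tw a * tw b" "\<And>a. tw (tw a) = a" "tw 1 = 1"
  shows "f4_chain_ring (skew fr) (\<lambda>x. dec (fst x)) (\<lambda>b. (0, enc b)) tw"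
proof -
  have tw0: "tw 0 = 0" using tw(1)[of 0 0] by simp
  have car: "x \<in> carrier (skew fr) \<longleftrightarrow> (\<exists>a b. x = (enc a, enc b))" for x
    using range_enc by (cases x) (fastforce simp: skew_def)
  have mult: "(enc a, enc b) \<otimes>\<^bsub>skew fr\<^esub> (enc c, enc d) = (enc (a * c), enc (a * d + b * tw c))" for a b c d
    by (simp add: skew_def fr f4mul_enc f4add_enc)
  have add: "(enc a, enc b) \<oplus>\<^bsub>skew fr\<^esub> (enc c, enc d) = (enc (a + c), enc (b + d))" for a b c d
    by (simp add: skew_def f4add_enc)
  have one: "\<one>\<^bsub>skew fr\<^esub> = (enc 1, enc 0)" and zero: "\<zero>\<^bsub>skew fr\<^esub> = (enc 0, enc 0)"
    by (simp_all add: skew_def enc_one)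
  have ab: "abelian_group (skew fr)"
  proof (rule abelian_groupI)
    show "\<exists>y\<in>carrier (skew fr). y \<oplus>\<^bsub>skew fr\<^esub> x = \<zero>\<^bsub>skew fr\<^esub>" if "x \<in> carrier (skew fr)" for x
      using that by (intro bexI[of _ x]) (auto simp: car add zero)
  qed (auto simp: car add zero simp del: enc_zero intro: add.commute add.assoc)
  have mon: "monoid (skew fr)"
    by (rule monoidI) (auto simp: car mult one algebra_simps tw tw0 simp del: enc_zero)
  have "ring (skew fr)"
    by (rule ringI[OF ab mon]) (auto simp: car mult add algebra_simps tw)
  then interpret ring "skew fr" .
  \<comment> \<open>Writing 0 as \<open>enc 0\<close> lets the rules for encoded pairs
    apply.\<close>
  have z: "(0, enc b) = (enc 0, enc b)" for b by simp
  show ?thesis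
  proof (unfold_locales, unfold z)
    show "finite (carrier (skew fr))" by (simp add: skew_def)
    show "\<exists>r\<in>carrier (skew fr). dec (fst r) = a" for a
      by (rule bexI[of _ "(enc a, enc 0)"]) (auto simp: car simp del: enc_zero)
    show "dec (fst (x \<oplus>\<^bsub>skew fr\<^esub> y)) = dec (fst x) + dec (fst y)"
      if "x \<in> carrier (skew fr)" "y \<in> carrier (skew fr)" for x y
      using that by (auto simp: car add)
    show "dec (fst (x \<otimes>\<^bsub>skew fr\<^esub> y)) = dec (fst x) * dec (fst y)"
      if "x \<in> carrier (skew fr)" "y \<in> carrier (skew fr)" for x y
      using that by (auto simp: car mult)
    show "dec (fst \<one>\<^bsub>skew fr\<^esub>) = 1" by (simp only: one fst_conv dec_enc)
    show "(enc 0, enc b) \<in> carrier (skew fr)" for b unfolding car by blast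
    show "dec (fst (enc 0, enc b)) = 0" for b by (simp only: fst_conv dec_enc)
    show "\<exists>b. x = (enc 0, enc b)" if "x \<in> carrier (skew fr)" "dec (fst x) = 0" for x
      using that by (auto simp: car)
    show "(enc 0, enc b) \<oplus>\<^bsub>skew fr\<^esub> (enc 0, enc c) = (enc 0, enc (b + c))" for b c by (simp only: add add_0)
    show "(enc 0, enc b) = \<zero>\<^bsub>skew fr\<^esub> \<longleftrightarrow> b = 0" for b by (simp only: zero prod.inject enc_inject simp_thms)
    show "x \<otimes>\<^bsub>skew fr\<^esub> (enc 0, enc b) = (enc 0, enc (dec (fst x) * b))" if x: "x \<in> carrier (skew fr)" for x b
    proof -
      obtain c d where "x = (enc c, enc d)" using x unfolding car by blast
      then show ?thesis by (simp only: mult fst_conv dec_enc tw0 mult_zero_right add_0_right)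
    qed
    show "(enc 0, enc b) \<otimes>\<^bsub>skew fr\<^esub> x = (enc 0, enc (b * tw (dec (fst x))))" if x: "x \<in> carrier (skew fr)" for x b
    proof -
      obtain c d where "x = (enc c, enc d)" using x unfolding car by blast
      then show ?thesis by (simp only: mult fst_conv dec_enc mult_zero_left add_0)
    qed
  qed (rule tw(1-3))+
qed

lemma S4_eq: "S4 = skew (\<lambda>a. a)" by (simp add: S4_def skew_def)

lemma T4_eq: "T4 = skew f4frob" by (simp add: T4_def skew_def)

lemma S4_chain_ring: "f4_chain_ring S4 (\<lambda>x. dec (fst x)) (\<lambda>b. (0, enc b)) (\<lambda>a. a)"
  unfolding S4_eq by (rule skew_chain_ring) simp_all

lemma T4_chain_ring: "f4_chain_ring T4 (\<lambda>x. dec (fst x)) (\<lambda>b. (0, enc b)) (\<lambda>a. a * a)"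
  unfolding T4_eq
proof (rule skew_chain_ring)
  show "f4frob (enc a) = enc (a * a)" for a by (simp add: f4frob_def f4mul_enc)
  show "(a + b) * (a + b) = a * a + b * b" for a b :: f4 by (cases a; cases b; simp add: f4_defs)
  show "a * a * (a * a) = a" for a :: f4 by (cases a; simp add: f4_defs)
qed (simp_all add: algebra_simps)

text \<open>Reduction modulo 2, with \<open>X\<close> sent to the element encoded by 2; the argument
  of \<open>dec\<close> reads the two parities as binary digits.\<close>

definition red_G4 :: "nat \<times> nat \<Rightarrow> f4" where "red_G4 x = dec (fst x mod 2 + 2 * (snd x mod 2))"

text \<open>The radical is generated by 2: the two binary digits of \<open>a\<close> are
  doubled.\<close>

definition nil_G4 :: "f4 \<Rightarrow> nat \<times> nat" where "nil_G4 a = (2 * (enc a mod 2), 2 * (enc a div 2))"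

lemma ring_G4: "ring G4"
proof -
  have ab: "abelian_group G4"
  proof (rule abelian_groupI)
    show "\<exists>y\<in>carrier G4. y \<oplus>\<^bsub>G4\<^esub> x = \<zero>\<^bsub>G4\<^esub>" if "x \<in> carrier G4" for x
    proof -
      have "((4 - a) mod 4 + a) mod 4 = 0" if "a < 4" for a :: nat using that by (simp add: mod_simps)
      then show ?thesis using that
        by (intro bexI[of _ "((4 - fst x) mod 4, (4 - snd x) mod 4)"]) (auto simp: G4_def)
    qed
  qed (auto simp: G4_def mod_simps ac_simps)
  \<comment> \<open>Removes the inner reductions that arise from products of three elements and from
    products with sums.\<close>
  have m: "(p mod 4 * e + 3 * (q mod 4 * f)) mod 4 = (p * e + 3 * (q * f)) mod 4"
    "(p mod 4 * f + q mod 4 * e + 3 * (q mod 4 * f)) mod 4 = (p * f + q * e + 3 * (q * f)) mod 4"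
    "(e * (p mod 4) + 3 * (f * (q mod 4))) mod 4 = (e * p + 3 * (f * q)) mod 4"
    "(e * (q mod 4) + f * (p mod 4) + 3 * (f * (q mod 4))) mod 4 = (e * q + f * p + 3 * (f * q)) mod 4"
    for p q e f :: nat
    by (intro mod_add_cong mod_mult_cong; simp)+
  have mon: "monoid G4"
    by (rule monoidI) (auto simp: G4_def m, simp_all add: algebra_simps)
  show ?thesis
    by (rule ringI[OF ab mon]) (auto simp: G4_def m mod_add_eq, simp_all add: algebra_simps)
qed

lemma G4_chain_ring: "f4_chain_ring G4 red_G4 nil_G4 (\<lambda>a. a)"
proof -
  interpret ring G4 by (rule ring_G4)
  let ?C = "[(a,b). a \<leftarrow> [0,1,2,3::nat], b \<leftarrow> [0,1,2,3::nat]]" and ?F = "[F0,F1,F2,F3]"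
  let ?add = "\<lambda>x y :: nat \<times> nat. ((fst x + fst y) mod 4, (snd x + snd y) mod 4)"
  let ?mul = "\<lambda>x y :: nat \<times> nat. ((fst x * fst y + 3 * (snd x * snd y)) mod 4, (fst x * snd y + snd x * fst y + 3 * (snd x * snd y)) mod 4)"
  have C: "carrier G4 = set ?C"
  proof -
    have "{0..<4} \<times> {0..<4} = set ?C" by code_simp
    then show ?thesis by (simp only: G4_def partial_object.simps)
  qed
  have F: "b \<in> set ?F" for b by (cases b) simp_all
  have add: "x \<oplus>\<^bsub>G4\<^esub> y = ?add x y" for x y by (cases x; cases y) (simp add: G4_def)
  have mul: "x \<otimes>\<^bsub>G4\<^esub> y = ?mul x y" for x y by (cases x; cases y) (simp add: G4_def)
  have 1: "\<forall>x\<in>set ?C. \<forall>y\<in>set ?C. red_G4 (?add x y) = red_G4 x + red_G4 y \<and> red_G4 (?mul x y) = red_G4 x * red_G4 y"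
    by code_simp
  have 2: "\<forall>b\<in>set ?F. (\<exists>r\<in>set ?C. red_G4 r = b) \<and> nil_G4 b \<in> set ?C \<and> red_G4 (nil_G4 b) = 0 \<and> (nil_G4 b = (0,0) \<longleftrightarrow> b = 0)"
    by code_simp
  have 3: "\<forall>x\<in>set ?C. red_G4 x = 0 \<longrightarrow> (\<exists>b\<in>set ?F. x = nil_G4 b)" by code_simp
  have 4: "\<forall>b\<in>set ?F. \<forall>c\<in>set ?F. ?add (nil_G4 b) (nil_G4 c) = nil_G4 (b + c)" by code_simp
  have 5: "\<forall>x\<in>set ?C. \<forall>b\<in>set ?F. ?mul x (nil_G4 b) = nil_G4 (red_G4 x * b) \<and> ?mul (nil_G4 b) x = nil_G4 (b * red_G4 x)"
    by code_simp
  show ?thesis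
  proof
    show "finite (carrier G4)" by (simp add: C)
    show "red_G4 (x \<oplus>\<^bsub>G4\<^esub> y) = red_G4 x + red_G4 y" if "x \<in> carrier G4" "y \<in> carrier G4" for x y
      using 1 that unfolding C add by blast
    show "red_G4 (x \<otimes>\<^bsub>G4\<^esub> y) = red_G4 x * red_G4 y" if "x \<in> carrier G4" "y \<in> carrier G4" for x y
      using 1 that unfolding C mul by blast
    show "red_G4 \<one>\<^bsub>G4\<^esub> = 1" by (simp add: G4_def red_G4_def dec_def one_f4_def)
    show "\<exists>r\<in>carrier G4. red_G4 r = a" for a using 2 F unfolding C by blast
    show "nil_G4 b \<in> carrier G4" for b using 2 F unfolding C by blast
    show "red_G4 (nil_G4 b) = 0" for b using 2 F by blast
    show "\<exists>b. x = nil_G4 b" if "x \<in> carrier G4" "red_G4 x = 0" for x using 3 that unfolding C by blast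
    show "nil_G4 b \<oplus>\<^bsub>G4\<^esub> nil_G4 c = nil_G4 (b + c)" for b c using 4 F unfolding add by blast
    have "\<zero>\<^bsub>G4\<^esub> = (0, 0)" by (simp add: G4_def)
    then show "nil_G4 b = \<zero>\<^bsub>G4\<^esub> \<longleftrightarrow> b = 0" for b using 2 F by metis
    show "x \<otimes>\<^bsub>G4\<^esub> nil_G4 b = nil_G4 (red_G4 x * b)" if "x \<in> carrier G4" for x b
      using 5 F that unfolding C mul by blast
    show "nil_G4 b \<otimes>\<^bsub>G4\<^esub> x = nil_G4 (b * red_G4 x)" if "x \<in> carrier G4" for x b
      using 5 F that unfolding C mul by blast
  qed simp_all
qed

theorem theorem4p14:
  assumes "R = G4 \<or> R = S4 \<or> R = T4"
  shows "max_arc R 5 \<le> 68"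
  using assms f4_chain_ring.max_arc_le_68[OF G4_chain_ring]
    f4_chain_ring.max_arc_le_68[OF S4_chain_ring] f4_chain_ring.max_arc_le_68[OF T4_chain_ring]
  by blast

end
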